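(* Let $(X,d,\mu)$ be a metric measure space with $\mu$ Ahlfors $Q$-regular, and let $\varphi:X\to X$ be a non-singular Borel measurable map. Then: (c1) Let $p(\cdot)\in\mathcal{P}^{\log}_{\varphi^{+}}(X)$. If $u_\varphi$ is essentially bounded on $X$, then the operator $C_\varphi: f\mapsto f\circ\varphi$ maps $L^{p(\cdot)}(X)$ into itself. (c2) Let $p(\cdot)\in\mathcal{P}^{\log}_{\varphi^{-}}(X)$. If $C_\varphi$ maps $L^{p(\cdot)}(X)$ into itself, then there exists a positive constant $C$ such that $\mu(\varphi^{-1}(B))\le C\,\mu(B)$ for every open ball $B\subset X$, i.e. $\mathcal{U}(\varphi)<+\infty$. (c3) Let $p(\cdot)\in\mathcal{P}^{\log}_{\varphi}(X)$. If, in addition, $\mu$ is a doubling measure on $X$, then the following are equivalent: $u_\varphi$ is essentially bounded on $X$; $C_\varphi$ maps $L^{p(\cdot)}(X)$ into itself; $\mathcal{U}(\varphi)<+\infty$.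
   Context: $(X,d,\mu)$ is a metric space with a Borel regular measure $\mu$ such that every nonempty open set has positive measure and every bounded set has finite measure. $\mathcal{P}(X)$ is the set of Borel measurable functions $p:X\to[1,\infty)$. For $A\subset X$, $p^{+}_{A}=\operatorname{ess\,sup}_{x\in A}p(x)$ and $p^{-}_{A}=\operatorname{ess\,inf}_{x\in A}p(x)$. $L^{p(\cdot)}(X)$ is the set of measurable $f$ on $X$ such that $\rho(f/\eta)<\infty$ for some $\eta>0$, where $\rho(f)=\int_X|f(x)|^{p(x)}\,d\mu(x)$; it is normed by $\|f\|_{p(\cdot)}=\inf\{\eta>0:\rho(f/\eta)\le1\}$. The measure $\mu$ is Ahlfors $Q$-regular ($Q>0$) if there are positive constants $c,C$ with $c\,\mathrm{diam}(B)^Q\le\mu(B)\le C\,\mathrm{diam}(B)^Q$ for every ball $B\subset X$ with $\mathrm{diam}\,B\le 2\,\mathrm{diam}\,X$. It is doubling if there is $C>0$ with $\mu(B(x,2r))\le C\mu(B(x,r))$ for every ball $B(x,r)$. $\varphi$ is non-singular if $\mu(\varphi^{-1}(E))=0$ for every Borel $E$ with $\mu(E)=0$; then $u_\varphi\ge0$ denotes the Radon–Nikodym derivative of $\mu\circ\varphi^{-1}$ with respect to $\mu$, i.e. $\mu(\varphi^{-1}(E))=\int_E u_\varphi\,d\mu$ for all Borel $E$. Let $\mathcal{B}_0$ be the set of all open balls in $X$ and $\mathcal{U}(\varphi)=\sup_{B\in\mathcal{B}_0}\mu(\varphi^{-1}(B))/\mu(B)$. $LH_0(X)$: the $p(\cdot)\in\mathcal{P}(X)$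 for which there is a constant $K_0$ with $|p(x)-p(y)|\le \frac{K_0}{-\log d(x,y)}$ for all $x\ne y$ in $X$ with $d(x,y)<1/2$. $LH_\infty(X)$ (with a fixed base point $x_0\in X$): the $p(\cdot)\in\mathcal{P}(X)$ for which there are constants $K_\infty,p_\infty$ with $|p(x)-p_\infty|\le \frac{K_\infty}{\log(e+d(x,x_0))}$ for all $x\in X$. $LH(X)=LH_0(X)\cap LH_\infty(X)$. Define $$[\varphi]_{p^{+}}=\inf\left\{\frac{p^{+}_{B}}{p^{+}_{\varphi^{-1}(B)}}:B\in\mathcal{B}_0\right\},\qquad [\varphi]_{p^{-}}=\sup\left\{\frac{p^{-}_{B}}{p^{-}_{\varphi^{-1}(B)}}:B\in\mathcal{B}_0\right\},$$ where only balls $B$ with $\mu(\varphi^{-1}(B))>0$ are considered. Then $\mathcal{P}^{\log}_{\varphi^{+}}(X)=\{p(\cdot)\in LH(X):[\varphi]_{p^{+}}\ge1\}$, $\mathcal{P}^{\log}_{\varphi^{-}}(X)=\{p(\cdot)\in LH_0(X):[\varphi]_{p^{-}}\le1\}$, and $\mathcal{P}^{\log}_{\varphi}(X)=\mathcal{P}^{\log}_{\varphi^{+}}(X)\cap\mathcal{P}^{\log}_{\varphi^{-}}(X)$.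
   Formalization: In (c2) the exponent is additionally assumed to be essentially bounded, i.e. p^+_X < ∞; for unbounded p in LH_0(X) the claim of (c2) is false, already on the real line with Lebesgue measure. *)

theory Defs
  imports "HOL-Probability.Essential_Supremum"
begin

text \<open>The metric space X is the whole type. A Borel regular measure is represented by its restriction
  M to the Borel sets, which determines it: the outer measure it comes from is the one induced by M,
  and its measurable sets are those of \<^term>\<open>completion M\<close>.\<close>

definition metric_measure_space :: "'a::metric_space measure \<Rightarrow> bool" where
  "metric_measure_space M \<longleftrightarrow>
     sets M = sets borel \<and>
     (\<forall>U. open U \<longrightarrow> U \<noteq> {} \<longrightarrow> 0 < emeasure M U) \<and>
     (\<forall>S\<in>sets borel. bounded S \<longrightarrow> emeasure M S < \<infinity>)"

text \<open>\<^const>\<open>diameter\<close> is real-valued and unspecified on unbounded sets; for unbounded X the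
  restriction diam B \<open>\<le>\<close> 2 diam X is void. Balls are always bounded.\<close>

definition ahlfors_regular :: "real \<Rightarrow> 'a::metric_space measure \<Rightarrow> bool" where
  "ahlfors_regular Q M \<longleftrightarrow>
     (\<exists>c>0. \<exists>C>0. \<forall>x r. 0 < r \<longrightarrow>
        (bounded (UNIV :: 'a set) \<longrightarrow> diameter (ball x r) \<le> 2 * diameter (UNIV :: 'a set)) \<longrightarrow>
        ennreal (c * diameter (ball x r) powr Q) \<le> emeasure M (ball x r) \<and>
        emeasure M (ball x r) \<le> ennreal (C * diameter (ball x r) powr Q))"

definition doubling :: "'a::metric_space measure \<Rightarrow> bool" where
  "doubling M \<longleftrightarrow>
     (\<exists>C>0. \<forall>x r. 0 < r \<longrightarrow> emeasure M (ball x (2 * r)) \<le> ennreal C * emeasure M (ball x r))"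

definition open_balls :: "'a::metric_space set set" where
  "open_balls = {ball x r | x r. 0 < r}"

definition exponents :: "('a::metric_space \<Rightarrow> real) set" where
  "exponents = {p \<in> borel_measurable borel. \<forall>x. 1 \<le> p x}"

definition exp_plus :: "'a::metric_space measure \<Rightarrow> ('a \<Rightarrow> real) \<Rightarrow> 'a set \<Rightarrow> ereal" where
  "exp_plus M p A = esssup (restrict_space M A) (\<lambda>x. ereal (p x))"

text \<open>The essential infimum is minus the essential supremum of the negative.\<close>

definition exp_minus :: "'a::metric_space measure \<Rightarrow> ('a \<Rightarrow> real) \<Rightarrow> 'a set \<Rightarrow> ereal" where
  "exp_minus M p A = - esssup (restrict_space M A) (\<lambda>x. - ereal (p x))"

definition modular :: "'a::metric_space measure \<Rightarrow> ('a \<Rightarrow> real) \<Rightarrow> ('a \<Rightarrow> real) \<Rightarrow> ennreal" where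
  "modular M p f = (\<integral>\<^sup>+x. ennreal (\<bar>f x\<bar> powr p x) \<partial>completion M)"

definition Lp_var :: "'a::metric_space measure \<Rightarrow> ('a \<Rightarrow> real) \<Rightarrow> ('a \<Rightarrow> real) set" where
  "Lp_var M p =
     {f \<in> borel_measurable (completion M). \<exists>\<eta>>0. modular M p (\<lambda>x. f x / \<eta>) < \<infinity>}"

definition composition_op :: "('a \<Rightarrow> 'a) \<Rightarrow> ('a \<Rightarrow> real) \<Rightarrow> 'a \<Rightarrow> real" where
  "composition_op \<phi> f = f \<circ> \<phi>"

definition maps_Lp_into_itself ::
    "'a::metric_space measure \<Rightarrow> ('a \<Rightarrow> real) \<Rightarrow> ('a \<Rightarrow> 'a) \<Rightarrow> bool" where
  "maps_Lp_into_itself M p \<phi> \<longleftrightarrow> composition_op \<phi> ` Lp_var M p \<subseteq> Lp_var M p"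

definition nonsingular :: "'a::metric_space measure \<Rightarrow> ('a \<Rightarrow> 'a) \<Rightarrow> bool" where
  "nonsingular M \<phi> \<longleftrightarrow>
     (\<forall>E\<in>sets borel. emeasure M E = 0 \<longrightarrow> emeasure M (\<phi> -` E) = 0)"

definition u_deriv :: "'a::metric_space measure \<Rightarrow> ('a \<Rightarrow> 'a) \<Rightarrow> 'a \<Rightarrow> ennreal" where
  "u_deriv M \<phi> = RN_deriv M (distr M M \<phi>)"

definition ess_bounded :: "'a measure \<Rightarrow> ('a \<Rightarrow> ennreal) \<Rightarrow> bool" where
  "ess_bounded M u \<longleftrightarrow> esssup M u < \<infinity>"

definition U_const :: "'a::metric_space measure \<Rightarrow> ('a \<Rightarrow> 'a) \<Rightarrow> ennreal" where
  "U_const M \<phi> = (SUP B\<in>open_balls. emeasure M (\<phi> -` B) / emeasure M B)"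

definition LH_0 :: "('a::metric_space \<Rightarrow> real) set" where
  "LH_0 = {p \<in> exponents. \<exists>K0. \<forall>x y. x \<noteq> y \<longrightarrow> dist x y < 1/2 \<longrightarrow>
             \<bar>p x - p y\<bar> \<le> K0 / (- ln (dist x y))}"

definition LH_inf :: "'a::metric_space \<Rightarrow> ('a \<Rightarrow> real) set" where
  "LH_inf x0 = {p \<in> exponents. \<exists>K p_inf. \<forall>x. \<bar>p x - p_inf\<bar> \<le> K / ln (exp 1 + dist x x0)}"

definition LH :: "'a::metric_space \<Rightarrow> ('a \<Rightarrow> real) set" where
  "LH x0 = LH_0 \<inter> LH_inf x0"

definition phi_plus ::
    "'a::metric_space measure \<Rightarrow> ('a \<Rightarrow> 'a) \<Rightarrow> ('a \<Rightarrow> real) \<Rightarrow> ereal" where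
  "phi_plus M \<phi> p =
     (INF B\<in>{B \<in> open_balls. 0 < emeasure M (\<phi> -` B)}. exp_plus M p B / exp_plus M p (\<phi> -` B))"

definition phi_minus ::
    "'a::metric_space measure \<Rightarrow> ('a \<Rightarrow> 'a) \<Rightarrow> ('a \<Rightarrow> real) \<Rightarrow> ereal" where
  "phi_minus M \<phi> p =
     (SUP B\<in>{B \<in> open_balls. 0 < emeasure M (\<phi> -` B)}. exp_minus M p B / exp_minus M p (\<phi> -` B))"

definition P_log_plus ::
    "'a::metric_space measure \<Rightarrow> 'a \<Rightarrow> ('a \<Rightarrow> 'a) \<Rightarrow> ('a \<Rightarrow> real) set" where
  "P_log_plus M x0 \<phi> = {p \<in> LH x0. 1 \<le> phi_plus M \<phi> p}"

definition P_log_minus :: "'a::metric_space measure \<Rightarrow> ('a \<Rightarrow> 'a) \<Rightarrow> ('a \<Rightarrow> real) set" where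
  "P_log_minus M \<phi> = {p \<in> LH_0. phi_minus M \<phi> p \<le> 1}"

definition P_log :: "'a::metric_space measure \<Rightarrow> 'a \<Rightarrow> ('a \<Rightarrow> 'a) \<Rightarrow> ('a \<Rightarrow> real) set" where
  "P_log M x0 \<phi> = P_log_plus M x0 \<phi> \<inter> P_log_minus M \<phi>"

end

theory Submission
  imports Defs
begin

text \<open>
  Write \<open>\<mu>\<close> for the measure, \<open>u\<close> for the density of the image of \<open>\<mu>\<close> under \<open>\<phi>\<close>; then
  \<open>\<integral> h(\<phi>(x)) d\<mu> = \<integral> u h d\<mu>\<close> for every measurable \<open>h \<ge> 0\<close>. Log-Hoelder exponents are continuous and the
  space is separable, so shrinking balls turns the two conditions on essential bounds into pointwise
  ones: the condition on \<open>p\<^sup>+\<close> gives \<open>p \<le> p \<circ> \<phi>\<close> almost everywhere, and the condition on \<open>p\<^sup>-\<close> gives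
  \<open>p \<circ> \<phi> \<le> p\<close> almost everywhere (\<open>phi_plus_AE\<close>, \<open>phi_minus_AE\<close>).

  Let \<open>u\<close> be bounded and \<open>p \<le> p \<circ> \<phi>\<close>. Where \<open>|f \<circ> \<phi>| \<ge> 1\<close> the larger exponent may be used, and the change of
  variables bounds the modular of \<open>f \<circ> \<phi>\<close>. Where \<open>|f \<circ> \<phi>| < 1\<close>, the decay condition at infinity lets one
  pass from \<open>p(x)\<close> to a constant exponent and from there to \<open>p(\<phi>(x))\<close>, at the cost of a constant factor
  and of an additive error that is a negative power of the distance from the base point. The upper bound
  in Ahlfors regularity makes this error integrable (\<open>ess_bounded_imp_maps\<close>).

  Conversely, let composition preserve the space and \<open>p \<circ> \<phi> \<le> p\<close>. If \<open>g\<close> is integrable with values in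
  \<open>{0} \<union> [1,\<infinity>)\<close>, then \<open>f = g\<^bsup>1/p\<^esup>\<close> belongs to the space and \<open>|f \<circ> \<phi>|\<^bsup>p\<^esup> \<ge> g \<circ> \<phi>\<close>, so that \<open>\<integral> u g d\<mu>\<close>
  is finite. For unbounded \<open>u\<close> this is contradicted by a \<open>g\<close> that puts mass \<open>2\<^bsup>-k\<^esup>\<close> on a very small subset
  of \<open>{u > 4\<^bsup>k\<^esup>}\<close> for each \<open>k\<close> (\<open>maps_imp_ess_bounded\<close>). Thus \<open>u\<close> itself is bounded, and the bound on
  balls is obtained by integrating \<open>u\<close>.

  Finally, a bound \<open>\<mu>(\<phi>\<^bsup>-1\<^esup>(B)) \<le> K \<mu>(B)\<close> on balls extends to open sets by covering them with balls
  whose halves are disjoint, which costs one doubling constant, and to bounded Borel sets by outer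
  regularity; this bounds \<open>u\<close> (\<open>U_const_finite_imp_ess_bounded\<close>).
\<close>

section \<open>Separated sets and separability\<close>

lemma maximal_separated_subset:
  fixes A :: "'a::metric_space set"
  assumes "0 < e"
  obtains S where "S \<subseteq> A" "\<And>s t. s \<in> S \<Longrightarrow> t \<in> S \<Longrightarrow> s \<noteq> t \<Longrightarrow> e \<le> dist s t"
    "A \<subseteq> (\<Union>s\<in>S. ball s e)"
proof -
  let ?F = "{S. S \<subseteq> A \<and> (\<forall>s\<in>S. \<forall>t\<in>S. s \<noteq> t \<longrightarrow> e \<le> dist s t)}"
  have "\<exists>S\<in>?F. \<forall>T\<in>?F. S \<subseteq> T \<longrightarrow> T = S"
  proof (rule subset_Zorn_nonempty)
    show "?F \<noteq> {}" by blast
    fix \<C> assume C: "\<C> \<noteq> {}" "subset.chain ?F \<C>"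
    have "e \<le> dist s t" if "X \<in> \<C>" "s \<in> X" "Y \<in> \<C>" "t \<in> Y" "s \<noteq> t" for s t X Y
    proof -
      have "X \<subseteq> Y \<or> Y \<subseteq> X" using C(2) \<open>X \<in> \<C>\<close> \<open>Y \<in> \<C>\<close> by (simp add: subset_chain_def)
      moreover have "X \<in> ?F" "Y \<in> ?F" using C(2) \<open>X \<in> \<C>\<close> \<open>Y \<in> \<C>\<close> by (auto simp: subset_chain_def)
      ultimately show ?thesis using that by blast
    qed
    moreover have "\<Union>\<C> \<subseteq> A" using C(2) by (auto simp: subset_chain_def)
    ultimately show "\<Union>\<C> \<in> ?F" by blast
  qed
  then obtain S where S: "S \<in> ?F" "\<forall>T\<in>?F. S \<subseteq> T \<longrightarrow> T = S" by (rule bexE)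
  have "\<exists>s\<in>S. x \<in> ball s e" if "x \<in> A" for x
  proof (rule ccontr)
    assume *: "\<not> ?thesis"
    then have far: "\<And>s. s \<in> S \<Longrightarrow> e \<le> dist s x \<and> e \<le> dist x s" by (auto simp: dist_commute not_less)
    then have "insert x S \<in> ?F" using S(1) that by auto
    then have "insert x S = S" using bspec[OF S(2) \<open>insert x S \<in> ?F\<close>] by blast
    then show False using far[of x] assms by auto
  qed
  then have "A \<subseteq> (\<Union>s\<in>S. ball s e)" by blast
  then show thesis using S(1) that[of S] by blast
qed

locale borel_metric_measure =
  fixes M :: "'a::metric_space measure"
  assumes mms: "metric_measure_space M"
begin

lemma sets_M [simp, measurable_cong]: "sets M = sets borel"
  using mms by (simp add: metric_measure_space_def)

lemma space_M [simp]: "space M = UNIV"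
  using sets_eq_imp_space_eq[OF sets_M] by simp

lemma emeasure_open_pos: "open U \<Longrightarrow> U \<noteq> {} \<Longrightarrow> 0 < emeasure M U"
  using mms by (simp add: metric_measure_space_def)

lemma emeasure_bounded_finite: "S \<in> sets borel \<Longrightarrow> bounded S \<Longrightarrow> emeasure M S < \<infinity>"
  using mms by (simp add: metric_measure_space_def)

lemma emeasure_ball_pos: "0 < r \<Longrightarrow> 0 < emeasure M (ball x r)"
  by (intro emeasure_open_pos) auto

lemma emeasure_ball_finite: "emeasure M (ball x r) < \<infinity>"
  by (intro emeasure_bounded_finite) auto

lemma emeasure_ball_neq_top: "emeasure M (ball x r) \<noteq> top"
  using emeasure_ball_finite[of x r] by simp

text \<open>
  The balls of radius \<open>e/2\<close> around the points of \<open>S\<close> are disjoint and have positive measure. A bounded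
  region has finite measure, so it contains only finitely many of them whose measure exceeds \<open>1/n\<close>.
\<close>
lemma countable_separated:
  fixes S :: "'a set"
  assumes "0 < e" and sep: "\<And>s t. s \<in> S \<Longrightarrow> t \<in> S \<Longrightarrow> s \<noteq> t \<Longrightarrow> e \<le> dist s t"
  shows "countable S"
proof -
  fix x0 :: 'a
  define T where "T n = {s \<in> S. dist x0 s < real n \<and> 1 / real (Suc n) < measure M (ball s (e/2))}" for n
  have "finite (T n)" for n
  proof -
    let ?m = "measure M (ball x0 (real n + e))"
    have fm: "ball x r \<in> fmeasurable M" for x :: 'a and r
      using emeasure_ball_finite by (auto simp: fmeasurable_def)
    have "card F \<le> nat \<lceil>real (Suc n) * ?m\<rceil>" if F: "F \<subseteq> T n" "finite F" for F
    proof -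
      have disj: "disjoint_family_on (\<lambda>s. ball s (e/2)) F"
        unfolding disjoint_family_on_def
      proof safe
        fix s t x assume st: "s \<in> F" "t \<in> F" "s \<noteq> t" "x \<in> ball s (e/2)" "x \<in> ball t (e/2)"
        have "dist s t < e" using st(4,5) dist_triangle[of s t x] by (auto simp: dist_commute)
        moreover have "e \<le> dist s t" using sep[of s t] st F by (auto simp: T_def)
        ultimately show "x \<in> {}" by simp
      qed
      have "real (card F) * (1 / real (Suc n)) = (\<Sum>s\<in>F. 1 / real (Suc n))" by simp
      also have "\<dots> \<le> (\<Sum>s\<in>F. measure M (ball s (e/2)))"
        using F by (intro sum_mono) (auto simp: T_def)
      also have "\<dots> = measure M (\<Union>s\<in>F. ball s (e/2))"
        using disj F fm by (intro measure_finite_Union[symmetric]) (auto simp: emeasure_ball_neq_top)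
      also have "\<dots> \<le> ?m"
      proof (rule measure_mono_fmeasurable)
        show "(\<Union>s\<in>F. ball s (e/2)) \<subseteq> ball x0 (real n + e)"
        proof clarsimp
          fix s x assume "s \<in> F" "dist s x * 2 < e"
          then show "dist x0 x < real n + e"
            using F dist_triangle[of x0 x s] assms(1) by (auto simp: T_def)
        qed
      qed (auto intro!: fm sets.finite_UN F)
      finally have "real (card F) \<le> real (Suc n) * ?m" by (simp add: field_simps)
      then show ?thesis by linarith
    qed
    then show ?thesis using finite_if_finite_subsets_card_bdd[of "T n"] by blast
  qed
  moreover have "S \<subseteq> (\<Union>n. T n)"
  proof
    fix s assume s: "s \<in> S"
    have "0 < measure M (ball s (e/2))"
      using emeasure_ball_pos[of "e/2" s] emeasure_ball_finite[of s "e/2"] assms(1)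
      by (simp add: measure_def enn2real_positive_iff)
    then obtain n1 where n1: "1 / real (Suc n1) < measure M (ball s (e/2))"
      using nat_approx_posE by blast
    obtain n2 where n2: "dist x0 s < real n2" using reals_Archimedean2 by blast
    have "1 / real (Suc (max n1 n2)) \<le> 1 / real (Suc n1)" by (intro divide_left_mono) auto
    then have "s \<in> T (max n1 n2)" using s n1 n2 by (auto simp: T_def)
    then show "s \<in> (\<Union>n. T n)" by blast
  qed
  ultimately show ?thesis
    by (meson countable_UN countable_finite countable_subset countableI_type)
qed

lemma countable_dense:
  obtains D :: "'a set" where "countable D" "\<And>x e. 0 < e \<Longrightarrow> \<exists>d\<in>D. dist d x < e"
proof -
  have "\<exists>S::'a set. countable S \<and> UNIV \<subseteq> (\<Union>s\<in>S. ball s (1 / real (Suc n)))" for n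
  proof -
    have e: "0 < 1 / real (Suc n)" by simp
    show ?thesis
    proof (rule maximal_separated_subset[OF e, of UNIV])
      fix S :: "'a set"
      assume S: "\<And>s t. s \<in> S \<Longrightarrow> t \<in> S \<Longrightarrow> s \<noteq> t \<Longrightarrow> 1 / real (Suc n) \<le> dist s t"
        and cover: "UNIV \<subseteq> (\<Union>s\<in>S. ball s (1 / real (Suc n)))"
      have "countable S" using e S by (rule countable_separated)
      then show ?thesis using cover by blast
    qed
  qed
  then obtain S :: "nat \<Rightarrow> 'a set" where S: "\<And>n. countable (S n)"
    "\<And>n. UNIV \<subseteq> (\<Union>s\<in>S n. ball s (1 / real (Suc n)))" by metis
  show thesis
  proof (rule that[of "\<Union>n. S n"])
    fix x and e :: real assume "0 < e"
    then obtain n where n: "1 / real (Suc n) < e" using nat_approx_posE by blast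
    obtain s where "s \<in> S n" "dist s x < 1 / real (Suc n)" using S(2)[of n] by fastforce
    then show "\<exists>d\<in>\<Union>n. S n. dist d x < e" using n by (intro bexI[of _ s]) auto
  qed (auto simp: S)
qed

lemma sigma_finite: "sigma_finite_measure M"
proof
  fix x0 :: 'a
  show "\<exists>A. countable A \<and> A \<subseteq> sets M \<and> \<Union> A = space M \<and> (\<forall>a\<in>A. emeasure M a \<noteq> \<infinity>)"
  proof (intro exI conjI)
    show "countable (range (\<lambda>n. ball x0 (real n)))" by simp
    show "\<Union> (range (\<lambda>n. ball x0 (real n))) = space M"
      using reals_Archimedean2 by auto
  qed (use emeasure_ball_finite in \<open>auto simp: less_top\<close>)
qed

end

section \<open>Change of variables under a nonsingular map\<close>

locale nonsingular_map = borel_metric_measure M for M :: "'a::metric_space measure" +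
  fixes \<phi> :: "'a \<Rightarrow> 'a"
  assumes phi_borel [measurable]: "\<phi> \<in> borel_measurable borel" and nonsing: "nonsingular M \<phi>"
begin

lemma phi_M [measurable]: "\<phi> \<in> M \<rightarrow>\<^sub>M M"
  using phi_borel by (simp cong: measurable_cong_sets)

lemma vimage_phi [measurable]: "E \<in> sets borel \<Longrightarrow> \<phi> -` E \<in> sets borel"
  using measurable_sets[OF phi_borel, of E] by simp

lemma AE_compose:
  assumes "AE x in M. P x" shows "AE x in M. P (\<phi> x)"
proof -
  obtain N where N: "N \<in> null_sets M" "{x. \<not> P x} \<subseteq> N"
    using assms by (rule AE_E3) (use that in auto)
  then have "\<phi> -` N \<in> null_sets M"
    using nonsing by (auto simp: nonsingular_def null_sets_def)
  then show ?thesis by (rule AE_I') (use N in auto)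
qed

lemma density_u: "density M (u_deriv M \<phi>) = distr M M \<phi>"
proof -
  interpret sigma_finite_measure M by (rule sigma_finite)
  have "absolutely_continuous M (distr M M \<phi>)"
    using nonsing by (auto simp: absolutely_continuous_def null_sets_def emeasure_distr nonsingular_def)
  then show ?thesis unfolding u_deriv_def by (intro density_RN_deriv) auto
qed

lemma u_borel [measurable]: "u_deriv M \<phi> \<in> borel_measurable M"
  unfolding u_deriv_def by simp

lemma nn_integral_u_mult:
  assumes [measurable]: "h \<in> borel_measurable M"
  shows "(\<integral>\<^sup>+x. u_deriv M \<phi> x * h x \<partial>M) = (\<integral>\<^sup>+x. h (\<phi> x) \<partial>M)"
  by (subst nn_integral_density[symmetric])
     (simp_all add: density_u nn_integral_distr)

lemma compose_measurable:
  assumes "f \<in> borel_measurable (completion M)"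
  shows "f \<circ> \<phi> \<in> borel_measurable (completion M)"
proof -
  have "\<phi> \<in> completion M \<rightarrow>\<^sub>M completion M"
  proof (rule completion.measurable_completion2)
    show "\<phi> \<in> completion M \<rightarrow>\<^sub>M M" by (intro measurable_completion) simp
    show "null_sets M \<subseteq> null_sets (distr (completion M) M \<phi>)"
      using nonsing by (auto simp: distr_completion null_sets_def emeasure_distr nonsingular_def)
  qed
  then show ?thesis using assms by (rule measurable_comp)
qed

text \<open>
  The integrand need only be measurable for the completion, as the elements of the variable Lebesgue
  space are; nonsingularity allows replacing it by a Borel function.
\<close>
lemma nn_integral_compose_le:
  assumes "h \<in> borel_measurable (completion M)" and "AE x in M. u_deriv M \<phi> x \<le> K"
  shows "(\<integral>\<^sup>+x. h (\<phi> x) \<partial>M) \<le> K * (\<integral>\<^sup>+x. h x \<partial>M)"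
proof -
  obtain h' where h'[measurable]: "h' \<in> borel_measurable M" and eq: "AE x in M. h x = h' x"
    using completion_ex_borel_measurable[OF assms(1)] by blast
  have "(\<integral>\<^sup>+x. h (\<phi> x) \<partial>M) = (\<integral>\<^sup>+x. h' (\<phi> x) \<partial>M)"
    using AE_compose[OF eq] by (intro nn_integral_cong_AE)
  also have "\<dots> = (\<integral>\<^sup>+x. u_deriv M \<phi> x * h' x \<partial>M)"
    by (rule nn_integral_u_mult[symmetric]) simp
  also have "\<dots> \<le> (\<integral>\<^sup>+x. K * h' x \<partial>M)"
    using assms(2) by (intro nn_integral_mono_AE) (auto elim!: eventually_mono intro: mult_right_mono)
  also have "\<dots> = K * (\<integral>\<^sup>+x. h' x \<partial>M)" by (rule nn_integral_cmult) simp
  also have "(\<integral>\<^sup>+x. h' x \<partial>M) = (\<integral>\<^sup>+x. h x \<partial>M)"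
    using eq by (intro nn_integral_cong_AE) auto
  finally show ?thesis .
qed

lemma ess_bounded_AE:
  assumes "ess_bounded M (u_deriv M \<phi>)"
  obtains K :: real where "0 < K" "AE x in M. u_deriv M \<phi> x \<le> ennreal K"
proof -
  let ?s = "esssup M (u_deriv M \<phi>)"
  have "?s < \<infinity>" using assms by (simp add: ess_bounded_def)
  then have "?s \<le> ennreal (enn2real ?s + 1)" by (cases ?s) (auto intro!: ennreal_leI)
  then have "AE x in M. u_deriv M \<phi> x \<le> ennreal (enn2real ?s + 1)"
    using esssup_AE[of "u_deriv M \<phi>" M] by (auto elim: eventually_mono intro: order_trans)
  then show thesis by (intro that[of "enn2real ?s + 1"]) (auto intro: add_nonneg_pos)
qed

lemma ess_bounded_imp_borel_bound:
  assumes "ess_bounded M (u_deriv M \<phi>)"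
  obtains K :: real where "0 < K" "\<And>E. E \<in> sets borel \<Longrightarrow> emeasure M (\<phi> -` E) \<le> ennreal K * emeasure M E"
proof -
  obtain K where K: "0 < K" "AE x in M. u_deriv M \<phi> x \<le> ennreal K" using ess_bounded_AE[OF assms] .
  show thesis
  proof (rule that[OF K(1)])
    fix E :: "'a set" assume [measurable]: "E \<in> sets borel"
    have "emeasure M (\<phi> -` E) = (\<integral>\<^sup>+x. indicator E (\<phi> x) \<partial>M)"
      by (simp add: nn_integral_indicator[symmetric] indicator_def vimage_def del: nn_integral_indicator flip: indicator_vimage)
    also have "\<dots> \<le> ennreal K * (\<integral>\<^sup>+x. indicator E x \<partial>M)"
      by (rule nn_integral_compose_le[OF measurable_completion K(2)]) simp
    finally show "emeasure M (\<phi> -` E) \<le> ennreal K * emeasure M E" by simp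
  qed
qed


end

section \<open>Comparing the exponent at a point and at its image\<close>

context nonsingular_map
begin

text \<open>
  If \<open>\<phi>(x)\<close> lies in a small ball \<open>B\<close>, then \<open>x\<close> lies in \<open>\<phi>\<^bsup>-1\<^esup>(B)\<close>, so outside a null set that depends on
  \<open>B\<close> the value \<open>\<psi>(x)\<close> is at most the supremum of \<open>\<psi>\<close> on \<open>B\<close>, which is close to \<open>\<psi>(\<phi>(x))\<close>. Countably many
  balls suffice, with centres in a countable dense set and radii \<open>1/n\<close>.
\<close>
lemma le_compose_AE:
  fixes \<psi> :: "'a \<Rightarrow> real"
  assumes cont: "continuous_on UNIV \<psi>"
    and le: "\<And>B. B \<in> open_balls \<Longrightarrow> 0 < emeasure M (\<phi> -` B) \<Longrightarrow>
      esssup (restrict_space M (\<phi> -` B)) (\<lambda>x. ereal (\<psi> x)) \<le> esssup (restrict_space M B) (\<lambda>x. ereal (\<psi> x))"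
  shows "AE x in M. \<psi> x \<le> \<psi> (\<phi> x)"
proof -
  obtain D :: "'a set" where D: "countable D" "\<And>x e. 0 < e \<Longrightarrow> \<exists>d\<in>D. dist d x < e"
    by (rule countable_dense) blast
  have [measurable]: "\<psi> \<in> borel_measurable borel" using cont by (rule borel_measurable_continuous_onI)
  let ?B = "\<lambda>d n. ball d (1 / real (Suc n))"
  have "AE x in M. \<phi> x \<in> ?B d n \<longrightarrow> ereal (\<psi> x) \<le> (SUP y\<in>?B d n. ereal (\<psi> y))" for d n
  proof (cases "emeasure M (\<phi> -` ?B d n) = 0")
    case True
    then have "\<phi> -` ?B d n \<in> null_sets M" by (simp add: null_sets_def)
    then show ?thesis by (rule AE_I') auto
  next
    case False
    have "AE x in restrict_space M (\<phi> -` ?B d n). ereal (\<psi> x) \<le> esssup (restrict_space M (\<phi> -` ?B d n)) (\<lambda>x. ereal (\<psi> x))"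
      by (rule esssup_AE)
    then have 1: "AE x in M. x \<in> \<phi> -` ?B d n \<longrightarrow> ereal (\<psi> x) \<le> esssup (restrict_space M (\<phi> -` ?B d n)) (\<lambda>x. ereal (\<psi> x))"
      by (subst (asm) AE_restrict_space_iff) simp_all
    have "esssup (restrict_space M (\<phi> -` ?B d n)) (\<lambda>x. ereal (\<psi> x)) \<le> esssup (restrict_space M (?B d n)) (\<lambda>x. ereal (\<psi> x))"
    proof (rule le)
      show "?B d n \<in> open_balls" unfolding open_balls_def
        by (intro CollectI exI[of _ d] exI[of _ "1 / real (Suc n)"]) simp
      show "0 < emeasure M (\<phi> -` ?B d n)" using False by (simp add: zero_less_iff_neq_zero)
    qed
    also have "\<dots> \<le> (SUP y\<in>?B d n. ereal (\<psi> y))"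
      by (rule esssup_I) (auto intro!: measurable_restrict_space1 SUP_upper AE_I2 simp: space_restrict_space)
    finally show ?thesis using 1 by (auto elim!: eventually_mono)
  qed
  then have "AE x in M. \<forall>n. \<forall>d\<in>D. \<phi> x \<in> ?B d n \<longrightarrow> ereal (\<psi> x) \<le> (SUP y\<in>?B d n. ereal (\<psi> y))"
    using D(1) by (simp add: AE_all_countable AE_ball_countable)
  then show ?thesis
  proof (rule eventually_mono)
    fix x assume x: "\<forall>n. \<forall>d\<in>D. \<phi> x \<in> ?B d n \<longrightarrow> ereal (\<psi> x) \<le> (SUP y\<in>?B d n. ereal (\<psi> y))"
    show "\<psi> x \<le> \<psi> (\<phi> x)"
    proof (rule field_le_epsilon)
      fix e :: real assume "0 < e"
      have "isCont \<psi> (\<phi> x)" using cont by (simp add: continuous_on_eq_continuous_at)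
      then obtain \<delta> where \<delta>: "0 < \<delta>" "\<And>y. dist y (\<phi> x) < \<delta> \<Longrightarrow> dist (\<psi> y) (\<psi> (\<phi> x)) < e"
        using \<open>0 < e\<close> unfolding continuous_at_eps_delta by blast
      then obtain n where n: "1 / real (Suc n) < \<delta> / 2" using nat_approx_posE[of "\<delta> / 2"] by auto
      obtain d where d: "d \<in> D" "dist d (\<phi> x) < 1 / real (Suc n)" using D(2)[of "1 / real (Suc n)"] by auto
      have "ereal (\<psi> x) \<le> (SUP y\<in>?B d n. ereal (\<psi> y))" using x d by auto
      also have "\<dots> \<le> ereal (\<psi> (\<phi> x) + e)"
      proof (rule SUP_least)
        fix y assume "y \<in> ?B d n"
        then have "dist y (\<phi> x) < \<delta>"
          using d(2) n dist_triangle[of y "\<phi> x" d] by (simp add: dist_commute)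
        then show "ereal (\<psi> y) \<le> ereal (\<psi> (\<phi> x) + e)" using \<delta>(2)[of y] by (auto simp: dist_real_def)
      qed
      finally show "\<psi> x \<le> \<psi> (\<phi> x) + e" by simp
    qed
  qed
qed

end

lemma LH_0_continuous:
  assumes "p \<in> LH_0" shows "continuous_on UNIV p"
proof -
  obtain K0 where K0: "\<And>x y. x \<noteq> y \<Longrightarrow> dist x y < 1/2 \<Longrightarrow> \<bar>p x - p y\<bar> \<le> K0 / (- ln (dist x y))"
    using assms by (auto simp: LH_0_def)
  have lim: "((\<lambda>r. K0 / (- ln r)) \<longlongrightarrow> 0) (at_right (0::real))"
    by real_asymp
  have "isCont p x" for x
    unfolding continuous_at_eps_delta
  proof (intro allI impI)
    fix e :: real assume "0 < e"
    have "\<forall>\<^sub>F r in at_right 0. K0 / (- ln r) < e" using order_tendstoD(2)[OF lim \<open>0 < e\<close>] .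
    then obtain b where b: "0 < b" "\<And>r. 0 < r \<Longrightarrow> r < b \<Longrightarrow> K0 / (- ln r) < e"
      by (auto simp: eventually_at_right_field)
    have "dist (p y) (p x) < e" if "dist y x < min b (1/2)" for y
    proof (cases "y = x")
      case False
      then have "\<bar>p y - p x\<bar> \<le> K0 / (- ln (dist y x))" using K0 that by auto
      also have "\<dots> < e" using False that by (intro b(2)) auto
      finally show ?thesis by (simp add: dist_real_def)
    qed (use \<open>0 < e\<close> in auto)
    then show "\<exists>d>0. \<forall>y. dist y x < d \<longrightarrow> dist (p y) (p x) < e"
      using b(1) by (intro exI[of _ "min b (1/2)"]) auto
  qed
  then show ?thesis by (simp add: continuous_at_imp_continuous_on)
qed

text \<open>
  Division of extended reals has \<open>\<infinity> / \<infinity> = 0\<close> and \<open>x / 0 = \<plusminus>\<infinity>\<close> for nonzero \<open>x\<close>; a ratio carries the expected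
  information once its denominator is finite and positive.
\<close>
lemma ereal_le_of_ratio:
  fixes a b :: ereal
  assumes "1 \<le> b" "b < \<infinity>"
  shows "1 \<le> a / b \<Longrightarrow> b \<le> a" and "a / b \<le> 1 \<Longrightarrow> a \<le> b"
proof -
  have "0 < b" by (rule less_le_trans[OF _ assms(1)]) simp
  moreover have "b \<noteq> \<infinity>" using assms(2) by auto
  ultimately have [simp]: "0 < b" "b \<noteq> \<infinity>" by auto
  show "1 \<le> a / b \<Longrightarrow> b \<le> a" "a / b \<le> 1 \<Longrightarrow> a \<le> b"
    using ereal_le_divide_pos[of b 1 a] ereal_divide_le_pos[of b a 1] by simp_all
qed

lemma ereal_uminus_less_infty: "- \<infinity> < x \<Longrightarrow> - x < \<infinity>" for x :: ereal
  by (cases x) auto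

context borel_metric_measure
begin

lemma esssup_restrict_const_le:
  assumes "A \<in> sets borel" "0 < emeasure M A" "p \<in> borel_measurable borel" "\<And>x. c \<le> ereal (p x)"
  shows "c \<le> esssup (restrict_space M A) (\<lambda>x. ereal (p x))"
proof -
  let ?R = "restrict_space M A"
  have ne: "emeasure ?R (space ?R) \<noteq> 0"
    using assms(1,2) by (simp add: space_restrict_space emeasure_restrict_space)
  have "c = esssup ?R (\<lambda>x. c)" by (rule esssup_const[OF ne, symmetric])
  also have "\<dots> \<le> esssup ?R (\<lambda>x. ereal (p x))" using assms(4) by (intro esssup_mono) auto
  finally show ?thesis .
qed

lemma esssup_restrict_gt_minf:
  assumes "A \<in> sets borel" "0 < emeasure M A" "p \<in> borel_measurable borel"
  shows "- \<infinity> < esssup (restrict_space M A) (\<lambda>x. ereal (p x))"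
proof (rule ccontr)
  let ?R = "restrict_space M A"
  assume "\<not> ?thesis"
  then have "esssup ?R (\<lambda>x. ereal (p x)) = - \<infinity>" by simp
  with esssup_AE[of "\<lambda>x. ereal (p x)" ?R] have "AE x in ?R. False" by simp
  then have "AE x in M. x \<notin> A" by (subst (asm) AE_restrict_space_iff) (use assms in auto)
  then have "emeasure M A = 0" using assms(1) by (subst (asm) AE_iff_measurable[of A]) auto
  then show False using assms(2) by simp
qed

lemma exp_plus_bounds:
  assumes "A \<in> sets borel" "0 < emeasure M A" "p \<in> exponents" "\<And>x. p x \<le> P"
  shows "1 \<le> exp_plus M p A" "exp_plus M p A < \<infinity>"
proof -
  have [measurable]: "p \<in> borel_measurable borel" using assms by (simp add: exponents_def)
  show "1 \<le> exp_plus M p A" unfolding exp_plus_def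
    using assms by (intro esssup_restrict_const_le) (auto simp: exponents_def)
  have "exp_plus M p A \<le> ereal P" unfolding exp_plus_def
    using assms(4) by (intro esssup_I) (auto intro!: measurable_restrict_space1)
  then show "exp_plus M p A < \<infinity>" by (auto intro: le_less_trans)
qed

lemma exp_minus_bounds:
  assumes "A \<in> sets borel" "0 < emeasure M A" "p \<in> exponents"
  shows "1 \<le> exp_minus M p A" "exp_minus M p A < \<infinity>"
proof -
  have [measurable]: "p \<in> borel_measurable borel" using assms by (simp add: exponents_def)
  have "esssup (restrict_space M A) (\<lambda>x. - ereal (p x)) \<le> - 1"
    using assms(3)
    by (intro esssup_I) (auto intro!: measurable_restrict_space1 AE_I2 simp: exponents_def one_ereal_def)
  then show "1 \<le> exp_minus M p A" unfolding exp_minus_def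
    using ereal_minus_le_minus[of "-1" "esssup (restrict_space M A) (\<lambda>x. - ereal (p x))"] by simp
  have "- \<infinity> < esssup (restrict_space M A) (\<lambda>x. ereal (- p x))"
    using assms by (intro esssup_restrict_gt_minf) auto
  then show "exp_minus M p A < \<infinity>" unfolding exp_minus_def by (simp add: ereal_uminus_less_infty del: ereal_infty_less)
qed

end

context nonsingular_map
begin

lemma phi_plus_AE:
  assumes p: "p \<in> LH_0" "\<And>x. p x \<le> P" and plus: "1 \<le> phi_plus M \<phi> p"
  shows "AE x in M. p x \<le> p (\<phi> x)"
proof (rule le_compose_AE[OF LH_0_continuous[OF p(1)]])
  fix B :: "'a set" assume B: "B \<in> open_balls" "0 < emeasure M (\<phi> -` B)"
  then have [measurable]: "B \<in> sets borel" by (auto simp: open_balls_def)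
  have pe: "p \<in> exponents" using p by (simp add: LH_0_def)
  have "phi_plus M \<phi> p \<le> exp_plus M p B / exp_plus M p (\<phi> -` B)"
    unfolding phi_plus_def using B by (intro INF_lower) simp
  then have "1 \<le> exp_plus M p B / exp_plus M p (\<phi> -` B)" using plus by (rule order_trans[rotated])
  then have "exp_plus M p (\<phi> -` B) \<le> exp_plus M p B"
    by (rule ereal_le_of_ratio(1)[rotated 2])
       (use exp_plus_bounds[OF vimage_phi B(2) pe p(2)] in simp_all)
  then show "esssup (restrict_space M (\<phi> -` B)) (\<lambda>x. ereal (p x)) \<le> esssup (restrict_space M B) (\<lambda>x. ereal (p x))"
    by (simp add: exp_plus_def)
qed

text \<open>
  The essential infimum of \<open>p\<close> is minus the essential supremum of \<open>-p\<close>, so the comparison is applied to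
  \<open>-p\<close>.
\<close>
lemma phi_minus_AE:
  assumes p: "p \<in> LH_0" and minus: "phi_minus M \<phi> p \<le> 1"
  shows "AE x in M. p (\<phi> x) \<le> p x"
proof -
  have "AE x in M. - p x \<le> - p (\<phi> x)"
  proof (rule le_compose_AE)
    show "continuous_on UNIV (\<lambda>x. - p x)" using LH_0_continuous[OF p] by (rule continuous_on_minus)
    fix B :: "'a set" assume B: "B \<in> open_balls" "0 < emeasure M (\<phi> -` B)"
    then have [measurable]: "B \<in> sets borel" by (auto simp: open_balls_def)
    have pe: "p \<in> exponents" using p by (simp add: LH_0_def)
    have "exp_minus M p B / exp_minus M p (\<phi> -` B) \<le> phi_minus M \<phi> p"
      unfolding phi_minus_def using B by (intro SUP_upper) simp
    then have "exp_minus M p B / exp_minus M p (\<phi> -` B) \<le> 1" using minus by (rule order_trans)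
    then have "exp_minus M p B \<le> exp_minus M p (\<phi> -` B)"
      by (rule ereal_le_of_ratio(2)[rotated 2])
         (use exp_minus_bounds[OF vimage_phi B(2) pe] in simp_all)
    then show "esssup (restrict_space M (\<phi> -` B)) (\<lambda>x. ereal (- p x)) \<le> esssup (restrict_space M B) (\<lambda>x. ereal (- p x))"
      by (simp add: exp_minus_def)
  qed
  then show ?thesis by simp
qed

end

section \<open>Decay of the exponent at infinity\<close>

text \<open>
  In a bounded space every ball satisfies the restriction on its diameter, because a ball is a subset of
  the space. Hence the upper estimate holds for all radii.
\<close>
lemma ahlfors_upper_bound:
  fixes M :: "'a::metric_space measure"
  assumes "ahlfors_regular Q M" "0 < Q"
  obtains C where "0 < C" "\<And>x r. 0 < r \<Longrightarrow> emeasure M (ball x r) \<le> ennreal (C * r powr Q)"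
proof -
  obtain C where C: "0 < C" and le: "\<And>x r. 0 < r \<Longrightarrow>
      (bounded (UNIV :: 'a set) \<longrightarrow> diameter (ball x r) \<le> 2 * diameter (UNIV :: 'a set)) \<Longrightarrow>
      emeasure M (ball x r) \<le> ennreal (C * diameter (ball x r) powr Q)"
    using assms(1) unfolding ahlfors_regular_def by blast
  show thesis
  proof (rule that[of "C * 2 powr Q"])
    show "0 < C * 2 powr Q" using C by simp
    fix x :: 'a and r :: real assume r: "0 < r"
    have "diameter (ball x r) \<le> 2 * diameter (UNIV :: 'a set)" if bd: "bounded (UNIV :: 'a set)"
      using diameter_subset[OF subset_UNIV bd, of "ball x r"] diameter_ge_0[OF bd] by linarith
    then have "emeasure M (ball x r) \<le> ennreal (C * diameter (ball x r) powr Q)"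
      using le r by blast
    also have "\<dots> \<le> ennreal (C * 2 powr Q * r powr Q)"
    proof (rule ennreal_leI)
      have "diameter (ball x r) \<le> 2 * r"
      proof -
        have "dist y z \<le> 2 * r" if "y \<in> ball x r" "z \<in> ball x r" for y z
          using that dist_triangle3[of y z x] by simp
        then show ?thesis using r by (auto simp: diameter_def intro!: cSUP_least)
      qed
      then have "diameter (ball x r) powr Q \<le> (2 * r) powr Q"
        using assms(2) diameter_ge_0[of "ball x r"] by (intro powr_mono2) auto
      then show "C * diameter (ball x r) powr Q \<le> C * 2 powr Q * r powr Q"
        using C r by (simp add: powr_mult mult.assoc)
    qed
    finally show "emeasure M (ball x r) \<le> ennreal (C * 2 powr Q * r powr Q)" .
  qed
qed

lemma le_suminf_ennreal: "f k \<le> (\<Sum>n. f n)" for f :: "nat \<Rightarrow> ennreal"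
  using sum_le_suminf[of f "{k}"] by simp

text \<open>
  Changing an exponent by at most \<open>K / ln L\<close> multiplies the power \<open>t\<^sup>q\<close> by at most \<open>L\<^bsup>N K / ln L\<^esup> = e\<^bsup>N K\<^esup>\<close> as
  long as \<open>t > L\<^bsup>-N\<^esup>\<close>; for smaller \<open>t\<close> the power is at most \<open>L\<^bsup>-N\<^esup>\<close>, since \<open>q \<ge> 1\<close>. This is what the
  decay condition is used for, with \<open>L = e + d(x, x\<^sub>0)\<close>.
\<close>
lemma powr_exponent_change:
  fixes t q s L K N :: real
  assumes t: "0 \<le> t" "t \<le> 1" and q: "1 \<le> q" and L: "1 < L" and N: "0 < N"
    and qs: "\<bar>q - s\<bar> \<le> K / ln L"
  shows "t powr q \<le> exp (N * K) * t powr s + L powr - N"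
proof (cases "t \<le> L powr - N")
  case True
  have "t powr q \<le> t powr 1" using t q by (intro powr_mono') auto
  then have "t powr q \<le> L powr - N" using True t by simp
  moreover have "0 \<le> exp (N * K) * t powr s" by simp
  ultimately show ?thesis by linarith
next
  case False
  then have tL: "L powr - N < t" by simp
  moreover have "0 < L powr - N" using L by simp
  ultimately have t0: "0 < t" by linarith
  have "- N * ln L < ln t"
    using tL t0 L ln_less_cancel_iff[of "L powr - N" t] by (simp add: ln_powr)
  have "(q - s) * ln t \<le> \<bar>q - s\<bar> * (- ln t)"
    using abs_ge_self[of "(q - s) * ln t"] t t0 by (simp add: abs_mult abs_of_nonpos)
  also have "\<dots> \<le> (K / ln L) * (N * ln L)"
    using qs \<open>- N * ln L < ln t\<close> t t0 by (intro mult_mono) auto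
  also have "\<dots> = N * K" using L by simp
  finally have "t powr (q - s) \<le> exp (N * K)" using t0 by (simp add: powr_def)
  then have "t powr s * t powr (q - s) \<le> t powr s * exp (N * K)" by (intro mult_left_mono) auto
  then have "t powr q \<le> exp (N * K) * t powr s"
    using t0 by (simp add: powr_add[symmetric] mult.commute)
  then show ?thesis by (auto intro: add_increasing2)
qed

text \<open>
  The limit exponent can be taken to be at least 1: replacing it by its maximum with 1 does not
  increase its distance to any value of \<open>p\<close>, since these values are at least 1.
\<close>
lemma LH_infE:
  assumes "p \<in> LH_inf x0"
  obtains K s where "1 \<le> s" "0 \<le> K" "\<And>x. \<bar>p x - s\<bar> \<le> K / ln (exp 1 + dist x x0)"
proof -
  obtain K p_inf where K: "\<And>x. \<bar>p x - p_inf\<bar> \<le> K / ln (exp 1 + dist x x0)" and p: "\<And>x. 1 \<le> p x"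
    using assms by (auto simp: LH_inf_def exponents_def)
  show thesis
  proof (rule that[of "max 1 p_inf" K])
    have "0 \<le> \<bar>p x0 - p_inf\<bar>" by simp
    also have "\<dots> \<le> K" using K[of x0] by simp
    finally show "0 \<le> K" .
    show "\<bar>p x - max 1 p_inf\<bar> \<le> K / ln (exp 1 + dist x x0)" for x
      using K[of x] p[of x] by (auto simp: max_def abs_if split: if_splits)
  qed simp
qed

lemma LH_inf_bounded:
  assumes "p \<in> LH_inf x0"
  obtains P where "\<And>x. p x \<le> P"
proof -
  obtain K s where K: "1 \<le> s" "0 \<le> K" "\<And>x. \<bar>p x - s\<bar> \<le> K / ln (exp 1 + dist x x0)"
    using LH_infE[OF assms] by metis
  have "p x \<le> s + K" for x
  proof -
    have "ln (exp 1) \<le> ln (exp 1 + dist x x0)" by (intro ln_mono) (auto intro: add_pos_nonneg)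
    then have "1 \<le> ln (exp 1 + dist x x0)" by simp
    then have "K / ln (exp 1 + dist x x0) \<le> K / 1" using K(2) by (intro divide_left_mono) auto
    then show ?thesis using K(3)[of x] by simp
  qed
  then show thesis by (rule that)
qed

context borel_metric_measure
begin

text \<open>
  On the \<open>n\<close>-th annulus the weight is at most \<open>(n+1)\<^bsup>-(Q+2)\<^esup>\<close>, while the ball of radius \<open>n+1\<close> has measure
  at most \<open>C (n+1)\<^bsup>Q\<^esup>\<close>; what remains is the series of the inverse squares.
\<close>
lemma nn_integral_weight_finite:
  assumes Q: "0 < Q" and C: "0 < C" "\<And>x r. 0 < r \<Longrightarrow> emeasure M (ball x r) \<le> ennreal (C * r powr Q)"
  shows "(\<integral>\<^sup>+x. ennreal ((exp 1 + dist x x0) powr - (Q + 2)) \<partial>M) < \<infinity>"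
proof -
  let ?a = "\<lambda>n. ennreal (real (Suc n) powr - (Q + 2))"
  have "(\<integral>\<^sup>+x. ennreal ((exp 1 + dist x x0) powr - (Q + 2)) \<partial>M)
      \<le> (\<integral>\<^sup>+x. (\<Sum>n. ?a n * indicator (ball x0 (real (Suc n))) x) \<partial>M)"
  proof (rule nn_integral_mono)
    fix x
    define n where "n = nat \<lfloor>dist x x0\<rfloor>"
    have n: "real n \<le> dist x x0" "dist x x0 < real (Suc n)"
      unfolding n_def by (auto simp: of_nat_nat) linarith
    have "(1::real) \<le> exp 1" by simp
    then have "real (Suc n) \<le> exp 1 + dist x x0" using n unfolding of_nat_Suc by linarith
    then have "(exp 1 + dist x x0) powr - (Q + 2) \<le> real (Suc n) powr - (Q + 2)"
      using Q by (intro powr_mono2') auto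
    then have "ennreal ((exp 1 + dist x x0) powr - (Q + 2)) \<le> ?a n * indicator (ball x0 (real (Suc n))) x"
      using n(2) by (auto simp: dist_commute indicator_def intro: ennreal_leI)
    also have "\<dots> \<le> (\<Sum>n. ?a n * indicator (ball x0 (real (Suc n))) x)"
      by (rule le_suminf_ennreal)
    finally show "ennreal ((exp 1 + dist x x0) powr - (Q + 2)) \<le> (\<Sum>n. ?a n * indicator (ball x0 (real (Suc n))) x)" .
  qed
  also have "\<dots> = (\<Sum>n. \<integral>\<^sup>+x. ?a n * indicator (ball x0 (real (Suc n))) x \<partial>M)"
    by (intro nn_integral_suminf borel_measurable_times_ennreal borel_measurable_const borel_measurable_indicator) simp
  also have "\<dots> = (\<Sum>n. ?a n * emeasure M (ball x0 (real (Suc n))))"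
    by (intro suminf_cong nn_integral_cmult_indicator) simp
  also have "\<dots> \<le> (\<Sum>n. ennreal (C * inverse (real (Suc n) ^ 2)))"
  proof (intro suminf_le)
    fix n
    have "?a n * emeasure M (ball x0 (real (Suc n))) \<le> ?a n * ennreal (C * real (Suc n) powr Q)"
      using C(2)[of "real (Suc n)" x0] by (intro mult_left_mono) auto
    also have "\<dots> = ennreal (C * (real (Suc n) powr - (Q + 2) * real (Suc n) powr Q))"
      using C(1) by (simp add: ennreal_mult[symmetric] mult_ac)
    also have "real (Suc n) powr - (Q + 2) * real (Suc n) powr Q = inverse (real (Suc n) ^ 2)"
      by (simp add: powr_add[symmetric] powr_minus powr_numeral)
    finally show "?a n * emeasure M (ball x0 (real (Suc n))) \<le> ennreal (C * inverse (real (Suc n) ^ 2))" .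
  qed auto
  also have "\<dots> < \<infinity>"
  proof -
    have "summable (\<lambda>n. inverse (real (Suc n) ^ 2))"
      using inverse_power_summable[of 2] by (subst summable_Suc_iff) simp
    then have "summable (\<lambda>n. C * inverse (real (Suc n) ^ 2))" by (rule summable_mult)
    then show ?thesis using C(1) by (simp add: less_top[symmetric] ennreal_suminf_neq_top del: of_nat_Suc)
  qed
  finally show ?thesis .
qed

end

section \<open>A bounded density makes composition preserve the space\<close>

context nonsingular_map
begin

text \<open>
  The modular of \<open>f \<circ> \<phi>\<close> is estimated pointwise by \<open>h \<circ> \<phi> + w\<close> with \<open>h\<close> and \<open>w\<close> integrable. The constant
  exponent \<open>s\<close> serves as an intermediate step between \<open>p(x)\<close> and \<open>p(\<phi>(x))\<close>; going through it
  is why the square of \<open>A\<close> appears in \<open>h\<close>.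
\<close>
lemma ess_bounded_imp_maps:
  assumes Q: "0 < Q" "ahlfors_regular Q M"
    and p: "p \<in> LH_inf x0" and le: "AE x in M. p x \<le> p (\<phi> x)"
    and eb: "ess_bounded M (u_deriv M \<phi>)"
  shows "maps_Lp_into_itself M p \<phi>"
  unfolding maps_Lp_into_itself_def
proof (rule image_subsetI)
  fix f assume f: "f \<in> Lp_var M p"
  then obtain \<eta> where \<eta>: "0 < \<eta>" "modular M p (\<lambda>x. f x / \<eta>) < \<infinity>"
    and [measurable]: "f \<in> borel_measurable (completion M)"
    by (auto simp: Lp_var_def)
  obtain U where U: "0 < U" "AE x in M. u_deriv M \<phi> x \<le> ennreal U" using ess_bounded_AE[OF eb] by metis
  obtain K s where K: "1 \<le> s" "0 \<le> K" "\<And>x. \<bar>p x - s\<bar> \<le> K / ln (exp 1 + dist x x0)"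
    using LH_infE[OF p] by metis
  have p1: "1 \<le> p x" for x using p by (simp add: LH_inf_def exponents_def)
  have [measurable]: "p \<in> borel_measurable borel" using p by (simp add: LH_inf_def exponents_def)
  then have [measurable]: "p \<in> borel_measurable (completion M)"
    by (intro measurable_completion) (simp cong: measurable_cong_sets)
  obtain C where C: "0 < C" "\<And>x r. 0 < r \<Longrightarrow> emeasure M (ball x r) \<le> ennreal (C * r powr Q)"
    using ahlfors_upper_bound[OF Q(2,1)] by metis
  (* N exceeds Q + 1, so that w is integrable. *)
  define N where "N = Q + 2"
  define A where "A = exp (N * K)"
  define w where "w x = (exp 1 + dist x x0) powr - N" for x
  have e: "1 < exp 1 + dist x x0" for x
    by (rule less_le_trans[of _ "exp 1"]) auto
  have "continuous_on UNIV w"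
    unfolding w_def
  proof (intro continuous_intros ballI)
    show "exp 1 + dist x x0 \<noteq> 0" for x using e[of x] by linarith
  qed
  then have "w \<in> borel_measurable borel" by (rule borel_measurable_continuous_onI)
  then have [measurable]: "w \<in> borel_measurable M" "w \<in> borel_measurable (completion M)"
    by (auto intro!: measurable_completion cong: measurable_cong_sets)
  have w_fin: "(\<integral>\<^sup>+x. ennreal (w x) \<partial>M) < \<infinity>"
    unfolding w_def N_def using nn_integral_weight_finite[OF Q(1) C] .
  define H where "H y = \<bar>f y / \<eta>\<bar> powr p y" for y
  have H_fin: "(\<integral>\<^sup>+x. ennreal (H x) \<partial>M) < \<infinity>"
    using \<eta>(2) by (simp add: modular_def nn_integral_completion H_def)
  have H_meas [measurable]: "H \<in> borel_measurable (completion M)" unfolding H_def by measurable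
  define h where "h y = (1 + A\<^sup>2) * H y + A * w y" for y
  have [measurable]: "h \<in> borel_measurable (completion M)" unfolding h_def by measurable
  have nonneg: "0 \<le> A" "0 \<le> w y" "0 \<le> H y" "0 \<le> h y" for y by (auto simp: A_def w_def H_def h_def)
  have N: "0 < N" using Q(1) by (simp add: N_def)
  have small: "t powr p x \<le> A * t powr s + w x" "t powr s \<le> A * t powr p x + w x"
    if "0 \<le> t" "t \<le> 1" for t x
    unfolding A_def w_def
    using that K(1,3) p1 e N by (auto intro!: powr_exponent_change simp: abs_minus_commute)
  have bound: "\<bar>f (\<phi> x) / \<eta>\<bar> powr p x \<le> h (\<phi> x) + w x" if "p x \<le> p (\<phi> x)" for x
  proof (cases "\<bar>f (\<phi> x) / \<eta>\<bar> \<le> 1")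
    case True
    let ?t = "\<bar>f (\<phi> x) / \<eta>\<bar>"
    have "?t powr p x \<le> A * ?t powr s + w x" using small(1)[of ?t x] True by simp
    also have "\<dots> \<le> A * (A * ?t powr p (\<phi> x) + w (\<phi> x)) + w x"
      using small(2)[of ?t "\<phi> x"] True nonneg(1) by (intro add_right_mono mult_left_mono) auto
    also have "\<dots> \<le> h (\<phi> x) + w x"
      using nonneg(3)[of "\<phi> x"] by (simp add: h_def H_def algebra_simps power2_eq_square)
    finally show ?thesis .
  next
    case False
    then have "\<bar>f (\<phi> x) / \<eta>\<bar> powr p x \<le> H (\<phi> x)" unfolding H_def using that by (intro powr_mono) auto
    also have "\<dots> \<le> h (\<phi> x) + w x"
      using nonneg(1) nonneg(2)[of x] nonneg(2)[of "\<phi> x"] nonneg(3)[of "\<phi> x"]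
      by (simp add: h_def algebra_simps)
    finally show ?thesis .
  qed
  have "modular M p (\<lambda>x. (f \<circ> \<phi>) x / \<eta>) \<le> (\<integral>\<^sup>+x. ennreal (h (\<phi> x)) + ennreal (w x) \<partial>M)"
    unfolding modular_def nn_integral_completion
    using le by (intro nn_integral_mono_AE)
      (auto elim!: eventually_mono dest!: bound intro: ennreal_leI simp: ennreal_plus[symmetric] nonneg simp del: ennreal_plus)
  also have "\<dots> = (\<integral>\<^sup>+x. ennreal (h (\<phi> x)) + ennreal (w x) \<partial>completion M)"
    by (simp add: nn_integral_completion)
  also have "\<dots> = (\<integral>\<^sup>+x. ennreal (h (\<phi> x)) \<partial>completion M) + (\<integral>\<^sup>+x. ennreal (w x) \<partial>completion M)"
    using compose_measurable[of h] by (intro nn_integral_add) (simp_all add: comp_def)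
  also have "\<dots> = (\<integral>\<^sup>+x. ennreal (h (\<phi> x)) \<partial>M) + (\<integral>\<^sup>+x. ennreal (w x) \<partial>M)"
    by (simp add: nn_integral_completion)
  also have "\<dots> < \<infinity>"
  proof -
    have "(\<integral>\<^sup>+x. ennreal (h x) \<partial>M) = (\<integral>\<^sup>+x. ennreal (1 + A\<^sup>2) * ennreal (H x) + ennreal A * ennreal (w x) \<partial>completion M)"
      using nonneg by (simp add: nn_integral_completion h_def ennreal_plus ennreal_mult add_nonneg_nonneg)
    also have "\<dots> = (\<integral>\<^sup>+x. ennreal (1 + A\<^sup>2) * ennreal (H x) \<partial>completion M) + (\<integral>\<^sup>+x. ennreal A * ennreal (w x) \<partial>completion M)"
      by (rule nn_integral_add) simp_all
    also have "\<dots> = ennreal (1 + A\<^sup>2) * (\<integral>\<^sup>+x. ennreal (H x) \<partial>completion M) + ennreal A * (\<integral>\<^sup>+x. ennreal (w x) \<partial>completion M)"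
      by (intro arg_cong2[where f="(+)"] nn_integral_cmult) simp_all
    also have "\<dots> = ennreal (1 + A\<^sup>2) * (\<integral>\<^sup>+x. ennreal (H x) \<partial>M) + ennreal A * (\<integral>\<^sup>+x. ennreal (w x) \<partial>M)"
      by (simp only: nn_integral_completion)
    also have "\<dots> < \<infinity>" using H_fin w_fin by (simp add: ennreal_mult_less_top)
    finally have "ennreal U * (\<integral>\<^sup>+x. ennreal (h x) \<partial>M) < \<infinity>" by (simp add: ennreal_mult_less_top)
    moreover have "(\<integral>\<^sup>+x. ennreal (h (\<phi> x)) \<partial>M) \<le> ennreal U * (\<integral>\<^sup>+x. ennreal (h x) \<partial>M)"
      using U(2) by (intro nn_integral_compose_le) auto
    ultimately show ?thesis using w_fin by (simp add: le_less_trans)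
  qed
  finally show "composition_op \<phi> f \<in> Lp_var M p"
    using compose_measurable[of f] \<eta>(1) by (auto simp: Lp_var_def composition_op_def)
qed

end

section \<open>Composition preserving the space makes the density bounded\<close>

context borel_metric_measure
begin

text \<open>
  Balls of small radius have small measure, and countably many of them cover the space; one of them must
  meet \<open>S\<close> in a set of positive measure.
\<close>
lemma small_positive_subset:
  assumes "0 < Q" "0 < C" and C: "\<And>x r. 0 < r \<Longrightarrow> emeasure M (ball x r) \<le> ennreal (C * r powr Q)"
    and S: "S \<in> sets borel" "0 < emeasure M S" and "0 < \<epsilon>"
  shows "\<exists>E. E \<in> sets borel \<and> E \<subseteq> S \<and> 0 < emeasure M E \<and> emeasure M E \<le> ennreal \<epsilon>"
proof -
  obtain D :: "'a set" where D: "countable D" "\<And>x e. 0 < e \<Longrightarrow> \<exists>d\<in>D. dist d x < e"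
    by (rule countable_dense) blast
  define r where "r = (\<epsilon> / C) powr (1 / Q)"
  have r: "0 < r" "C * r powr Q = \<epsilon>" using assms by (auto simp: r_def powr_powr)
  have [measurable]: "S \<in> sets borel" by fact
  have "\<exists>d\<in>D. emeasure M (S \<inter> ball d r) \<noteq> 0"
  proof (rule ccontr)
    assume "\<not> ?thesis"
    then have "(\<Union>d\<in>D. S \<inter> ball d r) \<in> null_sets M"
      using D(1) by (intro null_sets_UN') (auto simp: null_sets_def)
    moreover have "(\<Union>d\<in>D. S \<inter> ball d r) = S" using D(2)[OF r(1)] by auto
    ultimately show False using S(2) by (simp add: null_sets_def)
  qed
  then obtain d where d: "emeasure M (S \<inter> ball d r) \<noteq> 0" by blast
  have "emeasure M (S \<inter> ball d r) \<le> emeasure M (ball d r)" by (intro emeasure_mono) auto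
  also have "\<dots> \<le> ennreal \<epsilon>" using C[OF r(1), of d] r(2) by simp
  finally show ?thesis
    using d by (intro exI[of _ "S \<inter> ball d r"]) (simp add: zero_less_iff_neq_zero)
qed

end

context nonsingular_map
begin

text \<open>
  The test function is \<open>f = g\<^bsup>1/p\<^esup>\<close>, whose modular is the integral of \<open>g\<close>. At \<open>x\<close> one finds
  \<open>f(\<phi>(x))\<^bsup>p(x)\<^esup> = g(\<phi>(x))\<^bsup>p(x) / p(\<phi>(x))\<^esup>\<close>, and this is at least \<open>g(\<phi>(x))\<close> because the exponent is at
  least 1 and \<open>g\<close> takes no value strictly between 0 and 1. The bound \<open>P\<close> removes the scaling by \<open>\<eta>\<close>.
\<close>
lemma maps_imp_integral_finite:
  assumes maps: "maps_Lp_into_itself M p \<phi>"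
    and p: "p \<in> exponents" and ge: "AE x in M. p (\<phi> x) \<le> p x" and P: "AE x in M. p x \<le> P"
    and g [measurable]: "g \<in> borel_measurable borel" and g1: "\<And>x. g x = 0 \<or> 1 \<le> g x"
    and fin: "(\<integral>\<^sup>+x. g x \<partial>M) < \<infinity>"
  shows "(\<integral>\<^sup>+x. u_deriv M \<phi> x * g x \<partial>M) < \<infinity>"
proof -
  have [measurable]: "p \<in> borel_measurable borel" and p1: "\<And>x. 1 \<le> p x" using p by (auto simp: exponents_def)
  have to_M: "h \<in> borel_measurable M" if "h \<in> borel_measurable borel" for h :: "'a \<Rightarrow> real"
    using that by (simp cong: measurable_cong_sets)
  have [measurable]: "g \<in> borel_measurable M" using g by (simp cong: measurable_cong_sets)
  have g_fin: "AE x in M. g x \<noteq> \<infinity>" using fin by (intro nn_integral_noteq_infinite) auto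
  (* enn2real sends infinity to 0, which changes g on a null set only. *)
  define f where "f x = enn2real (g x) powr (1 / p x)" for x
  have f_meas [measurable]: "f \<in> borel_measurable borel" unfolding f_def by measurable
  have "modular M p (\<lambda>x. f x / 1) = (\<integral>\<^sup>+x. g x \<partial>M)"
    unfolding modular_def nn_integral_completion
  proof (rule nn_integral_cong_AE, use g_fin in \<open>rule eventually_mono\<close>)
    fix x assume "g x \<noteq> \<infinity>"
    moreover have "p x \<noteq> 0" using p1[of x] by linarith
    ultimately show "ennreal (\<bar>f x / 1\<bar> powr p x) = g x"
      by (cases "g x") (auto simp: f_def powr_powr)
  qed
  then have "f \<in> Lp_var M p"
    using fin measurable_completion[OF to_M[OF f_meas]] unfolding Lp_var_def
    by (auto intro!: exI[of _ "1::real"])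
  then have "f \<circ> \<phi> \<in> Lp_var M p"
    using maps by (auto simp: maps_Lp_into_itself_def composition_op_def)
  then obtain \<eta> where \<eta>: "0 < \<eta>" "modular M p (\<lambda>x. f (\<phi> x) / \<eta>) < \<infinity>" by (auto simp: Lp_var_def)
  define E where "E = max 1 \<eta> powr P"
  have "(\<integral>\<^sup>+x. u_deriv M \<phi> x * g x \<partial>M) = (\<integral>\<^sup>+x. g (\<phi> x) \<partial>M)" by (rule nn_integral_u_mult) simp
  also have "\<dots> \<le> (\<integral>\<^sup>+x. ennreal E * ennreal (\<bar>f (\<phi> x) / \<eta>\<bar> powr p x) \<partial>M)"
  proof (rule nn_integral_mono_AE)
    show "AE x in M. g (\<phi> x) \<le> ennreal E * ennreal (\<bar>f (\<phi> x) / \<eta>\<bar> powr p x)"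
      using ge P AE_compose[OF g_fin]
    proof eventually_elim
      fix x assume le: "p (\<phi> x) \<le> p x" "p x \<le> P" and "g (\<phi> x) \<noteq> \<infinity>"
      then obtain a where a: "g (\<phi> x) = ennreal a" "0 \<le> a" by (cases "g (\<phi> x)") auto
      show "g (\<phi> x) \<le> ennreal E * ennreal (\<bar>f (\<phi> x) / \<eta>\<bar> powr p x)"
      proof (cases "a = 0")
        case False
        then have a1: "1 \<le> a" using g1[of "\<phi> x"] a by auto
        have px: "1 \<le> p x" "1 \<le> p (\<phi> x)" using p1 by auto
        have "1 \<le> p x / p (\<phi> x)" using le(1) px by simp
        then have "a powr 1 \<le> a powr (p x / p (\<phi> x))" using a1 by (intro powr_mono) auto
        also have "\<dots> = \<bar>f (\<phi> x)\<bar> powr p x" using a by (simp add: f_def powr_powr)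
        also have "\<dots> = \<eta> powr p x * \<bar>f (\<phi> x) / \<eta>\<bar> powr p x"
          using \<eta>(1) by (simp add: powr_mult[symmetric])
        also have "\<dots> \<le> E * \<bar>f (\<phi> x) / \<eta>\<bar> powr p x"
        proof (rule mult_right_mono)
          have "\<eta> powr p x \<le> max 1 \<eta> powr p x" using \<eta>(1) px by (intro powr_mono2) auto
          also have "\<dots> \<le> E" unfolding E_def using le by (intro powr_mono) auto
          finally show "\<eta> powr p x \<le> E" .
        qed simp
        finally have "a \<le> E * \<bar>f (\<phi> x) / \<eta>\<bar> powr p x" using a1 by simp
        then show ?thesis using a by (simp add: ennreal_mult[symmetric] E_def ennreal_leI)
      qed (use a in simp)
    qed
  qed
  also have "\<dots> = ennreal E * (\<integral>\<^sup>+x. ennreal (\<bar>f (\<phi> x) / \<eta>\<bar> powr p x) \<partial>M)"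
    by (rule nn_integral_cmult) measurable
  also have "\<dots> < \<infinity>"
    using \<eta>(2) by (simp add: modular_def nn_integral_completion ennreal_mult_less_top)
  finally show ?thesis .
qed

text \<open>
  If \<open>u\<close> is unbounded, choose \<open>E\<^sub>k \<subseteq> {u > 4\<^bsup>k\<^esup>}\<close> with \<open>0 < \<mu>(E\<^sub>k) \<le> 2\<^bsup>-k\<^esup>\<close> and let \<open>g\<close> be the sum of the
  indicators of the \<open>E\<^sub>k\<close> with coefficients \<open>b\<^sub>k = 2\<^bsup>-k\<^esup> / \<mu>(E\<^sub>k)\<close>. The integral of \<open>g\<close> is the sum of the
  \<open>2\<^bsup>-k\<^esup>\<close>, the coefficients are at least 1 because \<open>E\<^sub>k\<close> is small, and the integral of \<open>u g\<close> is at least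
  \<open>4\<^bsup>k\<^esup> 2\<^bsup>-k\<^esup> = 2\<^bsup>k\<^esup>\<close> for every \<open>k\<close>.
\<close>
lemma maps_imp_ess_bounded:
  assumes Q: "0 < Q" "ahlfors_regular Q M"
    and maps: "maps_Lp_into_itself M p \<phi>"
    and p: "p \<in> exponents" "AE x in M. p (\<phi> x) \<le> p x" "AE x in M. p x \<le> P"
  shows "ess_bounded M (u_deriv M \<phi>)"
proof (rule ccontr)
  let ?u = "u_deriv M \<phi>"
  assume unbdd: "\<not> ess_bounded M ?u"
  obtain C where C: "0 < C" "\<And>x r. 0 < r \<Longrightarrow> emeasure M (ball x r) \<le> ennreal (C * r powr Q)"
    using ahlfors_upper_bound[OF Q(2,1)] by metis
  have u_borel' [measurable]: "?u \<in> borel_measurable borel" using u_borel by (simp cong: measurable_cong_sets)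
  have "\<forall>k. \<exists>E. E \<in> sets borel \<and> E \<subseteq> {x. ennreal (4 ^ k) < ?u x} \<and>
      0 < emeasure M E \<and> emeasure M E \<le> ennreal (1 / 2 ^ k)"
  proof
    fix k :: nat
    have meas: "{x. ennreal (4 ^ k) < ?u x} \<in> sets borel" by measurable
    have "ennreal (4 ^ k) < esssup M ?u"
      using unbdd by (simp add: ess_bounded_def less_top[symmetric])
    then have "0 < emeasure M {x. ennreal (4 ^ k) < ?u x}"
      using esssup_pos_measure[OF u_borel, of "ennreal (4 ^ k)"] by simp
    from small_positive_subset[OF Q(1) C meas this, of "1 / 2 ^ k"]
    show "\<exists>E. E \<in> sets borel \<and> E \<subseteq> {x. ennreal (4 ^ k) < ?u x} \<and>
      0 < emeasure M E \<and> emeasure M E \<le> ennreal (1 / 2 ^ k)" by fastforce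
  qed
  then obtain E where E_all: "\<forall>k. E k \<in> sets borel \<and> E k \<subseteq> {x. ennreal (4 ^ k) < ?u x} \<and>
      0 < emeasure M (E k) \<and> emeasure M (E k) \<le> ennreal (1 / 2 ^ k)"
    by (rule choice[THEN exE])
  then have E [measurable]: "E k \<in> sets borel"
    and Eu: "x \<in> E k \<Longrightarrow> ennreal (4 ^ k) < ?u x"
    and Epos: "0 < emeasure M (E k)" and Esmall: "emeasure M (E k) \<le> ennreal (1 / 2 ^ k)" for k x
    by auto
  have Efin: "emeasure M (E k) \<noteq> \<infinity>" for k using Esmall[of k] by (auto simp: top_unique)
  define b where "b k = ennreal (1 / 2 ^ k) / emeasure M (E k)" for k :: nat
  have self: "emeasure M (E k) / emeasure M (E k) = 1" for k
    using Epos[of k] Efin[of k] by (intro ennreal_divide_self) (auto simp: less_top)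
  have b_mass: "b k * emeasure M (E k) = ennreal (1 / 2 ^ k)" for k
    unfolding b_def ennreal_divide_times self by simp
  define g where "g x = (\<Sum>k. b k * indicator (E k) x)" for x
  have [measurable]: "g \<in> borel_measurable borel" unfolding g_def by measurable
  have [measurable]: "g \<in> borel_measurable M" by (simp cong: measurable_cong_sets)
  have term_le: "b k * indicator (E k) x \<le> g x" for k x
    unfolding g_def by (rule le_suminf_ennreal)
  have "g x = 0 \<or> 1 \<le> g x" for x
  proof (cases "\<exists>k. x \<in> E k")
    case True
    then obtain k where k: "x \<in> E k" by blast
    have "emeasure M (E k) / emeasure M (E k) \<le> b k"
      unfolding b_def by (rule divide_right_mono_ennreal[OF Esmall])
    then have "1 \<le> b k" by (simp only: self)
    also have "\<dots> \<le> g x" using term_le[of k x] k by simp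
    finally show ?thesis by simp
  qed (simp add: g_def)
  moreover have "(\<integral>\<^sup>+x. g x \<partial>M) < \<infinity>"
  proof -
    have "(\<integral>\<^sup>+x. g x \<partial>M) = (\<Sum>k. ennreal (1 / 2 ^ k))"
      unfolding g_def by (subst nn_integral_suminf) (simp_all add: nn_integral_cmult_indicator b_mass)
    also have "\<dots> < \<infinity>"
      using summable_geometric[of "1 / 2 :: real"]
      by (simp add: less_top[symmetric] ennreal_suminf_neq_top power_one_over)
    finally show ?thesis .
  qed
  ultimately have "(\<integral>\<^sup>+x. ?u x * g x \<partial>M) < \<infinity>"
    by (intro maps_imp_integral_finite[OF maps p]) auto
  then obtain B where B: "(\<integral>\<^sup>+x. ?u x * g x \<partial>M) = ennreal B" "0 \<le> B"
    by (cases "\<integral>\<^sup>+x. ?u x * g x \<partial>M") auto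
  have "2 ^ k \<le> B" for k :: nat
  proof -
    have "ennreal (2 ^ k) = ennreal (4 ^ k) * (b k * emeasure M (E k))"
      by (simp add: b_mass ennreal_mult[symmetric] power_mult_distrib[symmetric] power_divide[symmetric])
    also have "\<dots> = (\<integral>\<^sup>+x. ennreal (4 ^ k) * (b k * indicator (E k) x) \<partial>M)"
      by (simp add: nn_integral_cmult nn_integral_cmult_indicator)
    also have "\<dots> \<le> (\<integral>\<^sup>+x. ?u x * g x \<partial>M)"
    proof (rule nn_integral_mono)
      fix x
      show "ennreal (4 ^ k) * (b k * indicator (E k) x) \<le> ?u x * g x"
        using Eu[of x k] term_le[of k x] by (cases "x \<in> E k") (auto intro!: mult_mono)
    qed
    finally show ?thesis using B by simp
  qed
  moreover obtain k :: nat where "B < 2 ^ k" using real_arch_pow[of 2 B] by auto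
  ultimately show False using not_le by blast
qed

end

section \<open>Approximation of Borel sets by closed and open sets\<close>

text \<open>
  The erosions of an open set exhaust it by closed sets, and a ball of radius \<open>\<delta>\<close> around a point of the
  \<open>\<delta>\<close>-erosion stays inside the set. The first property is used for regularity, both are used for the
  covering argument.
\<close>
definition erosion :: "real \<Rightarrow> 'a::metric_space set \<Rightarrow> 'a set" where
  "erosion \<delta> U = {x. ball x \<delta> \<subseteq> U}"

lemma closed_erosion: "closed (erosion \<delta> U)"
proof -
  have "- erosion \<delta> U = (\<Union>y\<in>-U. ball y \<delta>)" by (auto simp: erosion_def dist_commute)
  then show ?thesis by (auto simp: closed_def intro!: open_UN)
qed

lemma incseq_erosion: "incseq (\<lambda>n. erosion (1 / real (Suc n)) U)"
proof (rule incseq_SucI)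
  fix n
  have "ball x (1 / real (Suc (Suc n))) \<subseteq> ball x (1 / real (Suc n))" for x :: 'a
    by (intro subset_ball) (simp add: field_simps)
  then show "erosion (1 / real (Suc n)) U \<subseteq> erosion (1 / real (Suc (Suc n))) U"
    by (auto simp: erosion_def)
qed

lemma Union_erosion:
  assumes "open U" shows "(\<Union>n. erosion (1 / real (Suc n)) U) = U"
proof (intro equalityI subsetI)
  fix x assume "x \<in> U"
  then obtain e where e: "0 < e" "ball x e \<subseteq> U" using assms by (auto simp: open_contains_ball)
  obtain n where "1 / real (Suc n) < e" using nat_approx_posE[OF e(1)] by blast
  then have "ball x (1 / real (Suc n)) \<subseteq> U" using e(2) subset_ball[of "1 / real (Suc n)" e x] by auto
  then show "x \<in> (\<Union>n. erosion (1 / real (Suc n)) U)" by (auto simp: erosion_def)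
qed (auto simp: erosion_def)

text \<open>
  The sets that can be squeezed between a closed and an open set up to measure \<open>e\<close>, for every
  \<open>e > 0\<close>, form a \<open>\<sigma>\<close>-algebra containing the open sets. In a countable union the open sets are united in full, whereas only finitely
  many of the closed ones are used, to keep their union closed.
\<close>
lemma closed_open_approximation:
  fixes M :: "'a::metric_space measure"
  assumes "finite_measure M" and sets [measurable_cong, simp]: "sets M = sets (borel :: 'a measure)" and E: "E \<in> sets borel" and "0 < e"
  shows "\<exists>F V. closed F \<and> open V \<and> F \<subseteq> E \<and> E \<subseteq> V \<and> measure M (V - F) < e"
proof -
  interpret finite_measure M by fact
  have meas [simp]: "S \<in> sets M" if "closed S \<or> open S" for S :: "'a set" using that by auto
  have "E \<in> sigma_sets UNIV {S. open S}" using E by (simp add: borel_def)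
  then show ?thesis using \<open>0 < e\<close>
  proof (induction arbitrary: e)
    case (Basic U)
    then have U: "open U" by simp
    let ?F = "\<lambda>n. erosion (1 / real (Suc n)) U"
    have sub: "?F n \<subseteq> U" for n using Union_erosion[OF U] by blast
    have "(\<lambda>n. measure M (?F n)) \<longlonglongrightarrow> measure M (\<Union>n. ?F n)"
      using incseq_erosion borel_closed[OF closed_erosion] by (intro finite_Lim_measure_incseq) auto
    then have "(\<lambda>n. measure M (?F n)) \<longlonglongrightarrow> measure M U" by (simp only: Union_erosion[OF U])
    then have "\<forall>\<^sub>F n in sequentially. measure M U - e < measure M (?F n)"
      using Basic.prems by (intro order_tendstoD) auto
    then obtain n where "measure M U - e < measure M (?F n)" by (auto simp: eventually_sequentially)
    then have "measure M (U - ?F n) < e"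
      using U borel_closed[OF closed_erosion] sub by (subst finite_measure_Diff) auto
    then show ?case
      using U sub by (intro exI[of _ "?F n"] exI[of _ U]) (simp add: closed_erosion)
  next
    case Empty
    then show ?case by (intro exI[of _ "{}"]) simp
  next
    case (Compl A)
    obtain F V where FV: "closed F" "open V" "F \<subseteq> A" "A \<subseteq> V" "measure M (V - F) < e"
      using Compl.IH[OF Compl.prems] by blast
    have "- F - - V = V - F" by auto
    then show ?case using FV by (intro exI[of _ "- V"] exI[of _ "- F"]) (auto simp: open_Compl closed_Compl)
  next
    case (Union A)
    have "\<forall>i. \<exists>FV. closed (fst FV) \<and> open (snd FV) \<and> fst FV \<subseteq> A i \<and> A i \<subseteq> snd FV \<and>
        measure M (snd FV - fst FV) < e / 4 * (1 / 2) ^ i"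
      using Union.IH[of "e / 4 * (1 / 2) ^ i" i for i] Union.prems by simp
    then obtain FV where FV_all: "\<forall>i. closed (fst (FV i)) \<and> open (snd (FV i)) \<and> fst (FV i) \<subseteq> A i \<and> A i \<subseteq> snd (FV i) \<and>
        measure M (snd (FV i) - fst (FV i)) < e / 4 * (1 / 2) ^ i"
      by (rule choice[THEN exE])
    define F V where "F i = fst (FV i)" and "V i = snd (FV i)" for i
    have FV: "closed (F i)" "open (V i)" "F i \<subseteq> A i" "A i \<subseteq> V i"
      "measure M (V i - F i) < e / 4 * (1 / 2) ^ i" for i
      using FV_all by (auto simp: F_def V_def)
    have [simp]: "V i \<in> sets borel" "F i \<in> sets borel" for i using FV(1,2) by auto
    have sum: "(\<lambda>i. e / 4 * (1 / 2) ^ i) sums (e / 4 * 2)"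
      using geometric_sums[of "1 / 2 :: real"] by (intro sums_mult) simp
    have summ: "summable (\<lambda>i. measure M (V i - F i))"
      by (rule summable_comparison_test'[OF sums_summable[OF sum], of 0]) (use FV(5) in \<open>auto intro: less_imp_le\<close>)
    let ?V = "\<Union>i. V i" and ?F = "\<lambda>n. \<Union>i<n. F i"
    have "measure M (?V - (\<Union>i. F i)) \<le> measure M (\<Union>i. V i - F i)"
      by (intro finite_measure_mono) (auto intro!: sets.countable_UN sets.Diff)
    also have "\<dots> \<le> (\<Sum>i. measure M (V i - F i))"
      using summ by (intro finite_measure_subadditive_countably) auto
    also have "\<dots> \<le> (\<Sum>i. e / 4 * (1 / 2) ^ i)"
      using FV(5) summ sums_summable[OF sum] by (intro suminf_le) (auto intro: less_imp_le)
    also have "\<dots> = e / 2" using sums_unique[OF sum] by simp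
    finally have lim: "measure M (?V - (\<Union>i. F i)) < e" using Union.prems by simp
    have "(\<lambda>n. measure M (?V - ?F n)) \<longlonglongrightarrow> measure M (\<Inter>n. ?V - ?F n)"
    proof (intro finite_Lim_measure_decseq)
      have "closed (?F n)" "open ?V" for n using FV(1,2) by auto
      then show "range (\<lambda>n. ?V - ?F n) \<subseteq> sets M" by (auto intro!: sets.Diff)
      show "decseq (\<lambda>n. ?V - ?F n)" unfolding decseq_def
        by (intro allI impI Diff_mono order_refl UN_mono) auto
    qed
    also have "(\<Inter>n. ?V - ?F n) = ?V - (\<Union>i. F i)" by auto
    finally have "\<forall>\<^sub>F n in sequentially. measure M (?V - ?F n) < e" using lim by (rule order_tendstoD)
    then obtain n where "measure M (?V - ?F n) < e" by (auto simp: eventually_sequentially)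
    moreover have "closed (?F n)" "open ?V" using FV(1,2) by auto
    moreover have "?F n \<subseteq> (\<Union>i. A i)" "(\<Union>i. A i) \<subseteq> ?V" using FV(3,4) by blast+
    ultimately show ?case by (intro exI[of _ "?F n"] exI[of _ ?V]) simp
  qed
qed

section \<open>From balls to Borel sets under doubling\<close>

lemma emeasure_UN_le_disjoint:
  assumes S: "countable S" and A: "\<And>s. s \<in> S \<Longrightarrow> A s \<in> sets M" and D: "\<And>s. s \<in> S \<Longrightarrow> D s \<in> sets M"
    and disj: "disjoint_family_on D S"
    and le: "\<And>s. s \<in> S \<Longrightarrow> emeasure M (A s) \<le> c * emeasure M (D s)"
  shows "emeasure M (\<Union>s\<in>S. A s) \<le> c * emeasure M (\<Union>s\<in>S. D s)"
proof -
  let ?I = "to_nat_on S ` S" and ?g = "from_nat_into S"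
  define A' where "A' n = (if n \<in> ?I then A (?g n) else {})" for n
  define D' where "D' n = (if n \<in> ?I then D (?g n) else {})" for n
  have g: "?g n \<in> S" "to_nat_on S (?g n) = n" if "n \<in> ?I" for n
    using that S by auto
  have UA: "(\<Union>s\<in>S. A s) = (\<Union>n. A' n)" and UD: "(\<Union>s\<in>S. D s) = (\<Union>n. D' n)"
    using S g(1) by (auto simp: A'_def D'_def split: if_splits)
  have dj: "disjoint_family D'"
    unfolding disjoint_family_on_def
  proof (intro ballI impI)
    fix m n :: nat assume "m \<noteq> n"
    then show "D' m \<inter> D' n = {}"
    proof (cases "m \<in> ?I \<and> n \<in> ?I")
      case True
      then have "?g m \<noteq> ?g n" using g(2) \<open>m \<noteq> n\<close> by metis
      then show ?thesis
        using True disj g(1) by (simp add: D'_def disjoint_family_on_def)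
    qed (auto simp: D'_def)
  qed
  have "emeasure M (\<Union>n. A' n) \<le> (\<Sum>n. emeasure M (A' n))"
    using A g(1) by (intro emeasure_subadditive_countably) (auto simp: A'_def)
  also have "\<dots> \<le> (\<Sum>n. c * emeasure M (D' n))"
    using le g(1) by (intro suminf_le) (auto simp: A'_def D'_def)
  also have "\<dots> = c * (\<Sum>n. emeasure M (D' n))" by simp
  also have "(\<Sum>n. emeasure M (D' n)) = emeasure M (\<Union>n. D' n)"
    by (rule suminf_emeasure[OF _ dj]) (use D g(1) in \<open>auto simp: D'_def\<close>)
  finally show ?thesis by (simp only: UA UD)
qed

context nonsingular_map
begin

text \<open>
  Choose a maximal \<open>\<delta>\<close>-separated subset of the \<open>\<delta>\<close>-erosion of \<open>V\<close>. The \<open>\<delta>\<close>-balls around its points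
  cover the erosion, the concentric balls of half the radius are disjoint and lie in \<open>V\<close>, and doubling
  compares the two. Letting \<open>\<delta>\<close> tend to 0 exhausts \<open>V\<close>.
\<close>
lemma doubling_open_bound:
  assumes "doubling M" and ball: "\<And>x r. 0 < r \<Longrightarrow> emeasure M (\<phi> -` ball x r) \<le> ennreal K * emeasure M (ball x r)"
  shows "\<exists>K'>0. \<forall>V. open V \<longrightarrow> emeasure M (\<phi> -` V) \<le> ennreal K' * emeasure M V"
proof -
  obtain C where C: "0 < C" "\<And>x r. 0 < r \<Longrightarrow> emeasure M (ball x (2 * r)) \<le> ennreal C * emeasure M (ball x r)"
    using assms(1) unfolding doubling_def by blast
  define K' where "K' = (\<bar>K\<bar> + 1) * C"
  have ball': "emeasure M (\<phi> -` ball x \<delta>) \<le> ennreal K' * emeasure M (ball x (\<delta> / 2))" if "0 < \<delta>" for x \<delta>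
  proof -
    have "emeasure M (\<phi> -` ball x \<delta>) \<le> ennreal K * emeasure M (ball x \<delta>)" using ball that .
    also have "\<dots> \<le> ennreal (\<bar>K\<bar> + 1) * (ennreal C * emeasure M (ball x (\<delta> / 2)))"
      using C(2)[of "\<delta> / 2" x] that by (intro mult_mono ennreal_leI) auto
    also have "\<dots> = ennreal K' * emeasure M (ball x (\<delta> / 2))"
      using C(1) by (simp add: K'_def ennreal_mult mult.assoc)
    finally show ?thesis .
  qed
  have er: "emeasure M (\<phi> -` erosion \<delta> V) \<le> ennreal K' * emeasure M V" if V: "open V" and \<delta>: "0 < \<delta>" for V \<delta>
  proof (rule maximal_separated_subset[OF \<delta>, of "erosion \<delta> V"])
    fix S assume S: "S \<subseteq> erosion \<delta> V" and sep: "\<And>s t. s \<in> S \<Longrightarrow> t \<in> S \<Longrightarrow> s \<noteq> t \<Longrightarrow> \<delta> \<le> dist s t"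
      and cover: "erosion \<delta> V \<subseteq> (\<Union>s\<in>S. ball s \<delta>)"
    have S_ct: "countable S" using \<delta> sep by (rule countable_separated)
    have disj: "disjoint_family_on (\<lambda>s. ball s (\<delta> / 2)) S"
      unfolding disjoint_family_on_def
    proof safe
      fix s t x assume st: "s \<in> S" "t \<in> S" "s \<noteq> t" "x \<in> ball s (\<delta> / 2)" "x \<in> ball t (\<delta> / 2)"
      have "dist s t < \<delta>" using st(4,5) dist_triangle[of s t x] by (auto simp: dist_commute)
      then show "x \<in> {}" using sep[OF st(1-3)] by simp
    qed
    have "emeasure M (\<phi> -` erosion \<delta> V) \<le> emeasure M (\<Union>s\<in>S. \<phi> -` ball s \<delta>)"
    proof (rule emeasure_mono)
      show "\<phi> -` erosion \<delta> V \<subseteq> (\<Union>s\<in>S. \<phi> -` ball s \<delta>)" using cover by blast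
    qed (use S_ct in \<open>auto intro!: sets.countable_UN''\<close>)
    also have "\<dots> \<le> ennreal K' * emeasure M (\<Union>s\<in>S. ball s (\<delta> / 2))"
      using S_ct disj ball'[OF \<delta>] by (intro emeasure_UN_le_disjoint) auto
    also have "emeasure M (\<Union>s\<in>S. ball s (\<delta> / 2)) \<le> emeasure M V"
    proof (rule emeasure_mono)
      have "ball s (\<delta> / 2) \<subseteq> V" if "s \<in> S" for s
        using S that \<delta> subset_ball[of "\<delta> / 2" \<delta> s] by (auto simp: erosion_def)
      then show "(\<Union>s\<in>S. ball s (\<delta> / 2)) \<subseteq> V" by blast
    qed (use V in auto)
    finally show ?thesis by (simp add: mult_left_mono)
  qed
  show ?thesis
  proof (intro exI conjI allI impI)
    show "0 < K'" unfolding K'_def using C(1) by (intro mult_pos_pos) auto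
    fix V :: "'a set" assume V: "open V"
    let ?A = "\<lambda>n. \<phi> -` erosion (1 / real (Suc n)) V"
    have "emeasure M (\<phi> -` V) = emeasure M (\<Union>n. ?A n)"
      using Union_erosion[OF V] by (metis vimage_UN)
    also have "\<dots> = (SUP n. emeasure M (?A n))"
      using incseq_erosion[of V] vimage_phi[OF borel_closed[OF closed_erosion]]
      by (intro SUP_emeasure_incseq[symmetric]) (auto simp: incseq_def)
    also have "\<dots> \<le> ennreal K' * emeasure M V" using er[OF V] by (intro SUP_least) auto
    finally show "emeasure M (\<phi> -` V) \<le> ennreal K' * emeasure M V" .
  qed
qed

text \<open>
  The measure of \<open>E\<close> is approximated by that of open supersets. As the whole space may have infinite
  measure, the approximation is carried out for the restriction of the measure to a ball containing \<open>E\<close>.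
\<close>
lemma open_bound_imp_borel_bound:
  assumes "0 \<le> K" and open_le: "\<And>V. open V \<Longrightarrow> emeasure M (\<phi> -` V) \<le> ennreal K * emeasure M V"
    and E: "E \<in> sets borel" "bounded E"
  shows "emeasure M (\<phi> -` E) \<le> ennreal K * emeasure M E"
proof (rule ennreal_le_epsilon)
  fix e :: real assume "0 < e"
  fix x0 :: 'a
  obtain r where r: "E \<subseteq> ball x0 r" using E(2) bounded_subset_ballD by blast
  let ?N = "density M (indicator (ball x0 r))"
  have N: "emeasure ?N S = emeasure M (ball x0 r \<inter> S)" if "S \<in> sets borel" for S
    using that by (intro emeasure_restricted) auto
  interpret N: finite_measure ?N
    by rule (simp add: N[of UNIV, simplified] emeasure_ball_neq_top)
  obtain F V where FV: "closed F" "open V" "F \<subseteq> E" "E \<subseteq> V" "measure ?N (V - F) < e / (K + 1)"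
    using closed_open_approximation[OF N.finite_measure_axioms, of E "e / (K + 1)"] E(1) \<open>0 < e\<close> assms(1) by auto
  let ?V = "ball x0 r \<inter> V"
  have "emeasure M (?V - E) \<le> emeasure ?N (V - F)"
    using FV E(1) by (subst N) (auto intro!: emeasure_mono)
  also have "\<dots> \<le> ennreal (e / (K + 1))"
    using FV(5) by (simp add: N.emeasure_eq_measure ennreal_leI)
  finally have small: "emeasure M (?V - E) \<le> ennreal (e / (K + 1))" .
  have EV: "E \<subseteq> ?V" using r FV(4) by blast
  have "emeasure M (\<phi> -` E) \<le> emeasure M (\<phi> -` ?V)" using EV FV(2) by (intro emeasure_mono) auto
  also have "\<dots> \<le> ennreal K * emeasure M ?V" using FV(2) by (intro open_le) auto
  also have "emeasure M ?V = emeasure M E + emeasure M (?V - E)"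
    using EV FV(2) E(1) by (subst plus_emeasure) (auto intro: arg_cong[where f="emeasure M"])
  also have "ennreal K * \<dots> \<le> ennreal K * emeasure M E + ennreal K * ennreal (e / (K + 1))"
    using small by (simp add: distrib_left mult_left_mono add_left_mono)
  also have "ennreal K * ennreal (e / (K + 1)) \<le> ennreal e"
    using assms(1) \<open>0 < e\<close> by (simp add: ennreal_mult[symmetric] ennreal_leI field_simps)
  finally show "emeasure M (\<phi> -` E) \<le> ennreal K * emeasure M E + ennreal e"
    by (simp add: add_left_mono)
qed

text \<open>
  On a bounded part of \<open>{u > 2 K}\<close>, of measure \<open>m < \<infinity>\<close>, integrating \<open>u\<close> gives \<open>2 K m \<le> K m\<close>, so \<open>m = 0\<close>.
\<close>
lemma borel_bound_imp_ess_bounded: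
  assumes "0 < K" and le: "\<And>E. E \<in> sets borel \<Longrightarrow> bounded E \<Longrightarrow> emeasure M (\<phi> -` E) \<le> ennreal K * emeasure M E"
  shows "ess_bounded M (u_deriv M \<phi>)"
proof -
  let ?u = "u_deriv M \<phi>"
  fix x0 :: 'a
  have [measurable]: "?u \<in> borel_measurable borel" using u_borel by (simp cong: measurable_cong_sets)
  define A where "A n = {x. ennreal (2 * K) < ?u x} \<inter> ball x0 (real n)" for n
  have A [measurable]: "A n \<in> sets borel" for n unfolding A_def by measurable
  have "A n \<in> null_sets M" for n
  proof -
    have fin: "emeasure M (A n) < \<infinity>"
      using A by (intro emeasure_bounded_finite) (auto simp: A_def)
    have "ennreal (2 * K) * emeasure M (A n) = (\<integral>\<^sup>+x. ennreal (2 * K) * indicator (A n) x \<partial>M)"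
      by (simp add: nn_integral_cmult_indicator)
    also have "\<dots> \<le> (\<integral>\<^sup>+x. ?u x * indicator (A n) x \<partial>M)"
      by (intro nn_integral_mono) (auto simp: A_def indicator_def)
    also have "\<dots> = (\<integral>\<^sup>+x. indicator (A n) (\<phi> x) \<partial>M)" by (rule nn_integral_u_mult) simp
    also have "\<dots> = emeasure M (\<phi> -` A n)"
      by (simp add: nn_integral_indicator[symmetric] indicator_def vimage_def del: nn_integral_indicator)
    also have "\<dots> \<le> ennreal K * emeasure M (A n)" by (intro le A) (auto simp: A_def)
    finally have "emeasure M (A n) = 0"
      using fin assms(1)
      by (cases "emeasure M (A n)") (auto simp: ennreal_mult[symmetric])
    then show ?thesis using A by (simp add: null_sets_def)
  qed
  then have "(\<Union>n. A n) \<in> null_sets M" by (intro null_sets_UN) auto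
  moreover have "{x. \<not> ?u x \<le> ennreal (2 * K)} \<subseteq> (\<Union>n. A n)"
    using reals_Archimedean2 by (auto simp: A_def not_le)
  ultimately have "AE x in M. ?u x \<le> ennreal (2 * K)" by (intro AE_I'[of "\<Union>n. A n"]) auto
  then have "esssup M ?u \<le> ennreal (2 * K)" by (intro esssup_I u_borel)
  then show ?thesis unfolding ess_bounded_def by (auto intro: le_less_trans)
qed

lemma U_const_finite_imp_ess_bounded:
  assumes "doubling M" "U_const M \<phi> < \<infinity>"
  shows "ess_bounded M (u_deriv M \<phi>)"
proof -
  obtain U where U: "U_const M \<phi> = ennreal U" using assms(2) by (cases "U_const M \<phi>") auto
  have ball: "emeasure M (\<phi> -` ball x r) \<le> ennreal U * emeasure M (ball x r)" if r: "0 < r" for x r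
  proof -
    have "emeasure M (\<phi> -` ball x r) / emeasure M (ball x r) \<le> U_const M \<phi>"
      unfolding U_const_def using r by (intro SUP_upper) (auto simp: open_balls_def)
    then have "emeasure M (\<phi> -` ball x r) / emeasure M (ball x r) * emeasure M (ball x r) \<le> ennreal U * emeasure M (ball x r)"
      unfolding U by (rule mult_right_mono) simp
    then show ?thesis
      using emeasure_ball_pos[OF r, of x] emeasure_ball_finite[of x r]
      by (simp add: ennreal_divide_times ennreal_times_divide[symmetric])
  qed
  obtain K where K: "0 < K" "\<And>V. open V \<Longrightarrow> emeasure M (\<phi> -` V) \<le> ennreal K * emeasure M V"
    using doubling_open_bound[OF assms(1) ball] by blast
  show ?thesis
    by (rule borel_bound_imp_ess_bounded[OF K(1)])
      (rule open_bound_imp_borel_bound[OF less_imp_le[OF K(1)] K(2)])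
qed

lemma ess_bounded_imp_U_const_finite:
  assumes "ess_bounded M (u_deriv M \<phi>)"
  shows "(\<exists>C>0. \<forall>B \<in> open_balls. emeasure M (\<phi> -` B) \<le> ennreal C * emeasure M B) \<and> U_const M \<phi> < \<infinity>"
proof -
  obtain K where K: "0 < K" "\<And>E. E \<in> sets borel \<Longrightarrow> emeasure M (\<phi> -` E) \<le> ennreal K * emeasure M E"
    using ess_bounded_imp_borel_bound[OF assms] by metis
  have ball: "\<forall>B \<in> open_balls. emeasure M (\<phi> -` B) \<le> ennreal K * emeasure M B"
    using K(2) by (auto simp: open_balls_def)
  have "U_const M \<phi> \<le> ennreal K" unfolding U_const_def
  proof (rule SUP_least)
    fix B :: "'a set" assume B: "B \<in> open_balls"
    then have "0 < emeasure M B" by (auto simp: open_balls_def emeasure_ball_pos)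
    then show "emeasure M (\<phi> -` B) / emeasure M B \<le> ennreal K"
      using ball B by (intro divide_le_posI_ennreal) (auto simp: mult.commute)
  qed
  then have "U_const M \<phi> < \<infinity>" by (auto intro: le_less_trans)
  then show ?thesis using ball K(1) by blast
qed

end

section \<open>Equivalence of the three conditions\<close>

theorem theorem2:
  fixes M :: "'a::metric_space measure" and \<phi> :: "'a \<Rightarrow> 'a" and x0 :: 'a and Q :: real
  assumes "metric_measure_space M"
    and "0 < Q" and "ahlfors_regular Q M"
    and "\<phi> \<in> borel_measurable borel" and "nonsingular M \<phi>"
  shows
    "(\<forall>p \<in> P_log_plus M x0 \<phi>. ess_bounded M (u_deriv M \<phi>) \<longrightarrow> maps_Lp_into_itself M p \<phi>) \<and>
     (\<forall>p \<in> P_log_minus M \<phi>. exp_plus M p UNIV < \<infinity> \<longrightarrow> maps_Lp_into_itself M p \<phi> \<longrightarrow>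
        (\<exists>C>0. \<forall>B \<in> open_balls. emeasure M (\<phi> -` B) \<le> ennreal C * emeasure M B) \<and>
        U_const M \<phi> < \<infinity>) \<and>
     (\<forall>p \<in> P_log M x0 \<phi>. doubling M \<longrightarrow>
        (ess_bounded M (u_deriv M \<phi>) \<longleftrightarrow> maps_Lp_into_itself M p \<phi>) \<and>
        (maps_Lp_into_itself M p \<phi> \<longleftrightarrow> U_const M \<phi> < \<infinity>))"
proof -
  interpret nonsingular_map M \<phi> by unfold_locales (fact assms)+
  have c1: "maps_Lp_into_itself M p \<phi>"
    if "p \<in> P_log_plus M x0 \<phi>" "ess_bounded M (u_deriv M \<phi>)" for p
  proof -
    have p: "p \<in> LH_0" "p \<in> LH_inf x0" "1 \<le> phi_plus M \<phi> p"
      using that by (auto simp: P_log_plus_def LH_def)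
    obtain P where "\<And>x. p x \<le> P" using LH_inf_bounded[OF p(2)] by metis
    then have "AE x in M. p x \<le> p (\<phi> x)" using phi_plus_AE[OF p(1) _ p(3)] by blast
    then show ?thesis using ess_bounded_imp_maps[OF assms(2,3) p(2) _ that(2)] by blast
  qed
  have c2: "ess_bounded M (u_deriv M \<phi>)"
    if "p \<in> P_log_minus M \<phi>" "exp_plus M p UNIV < \<infinity>" "maps_Lp_into_itself M p \<phi>" for p
  proof -
    have p: "p \<in> LH_0" "phi_minus M \<phi> p \<le> 1" "p \<in> exponents"
      using that by (auto simp: P_log_minus_def LH_0_def)
    define P where "P = real_of_ereal (exp_plus M p UNIV)"
    have "exp_plus M p UNIV \<le> ereal P" using that(2) unfolding P_def by (cases "exp_plus M p UNIV") auto
    moreover have "AE x in M. ereal (p x) \<le> exp_plus M p UNIV"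
      using esssup_AE[of "\<lambda>x. ereal (p x)" "restrict_space M UNIV"]
      unfolding exp_plus_def by (subst (asm) AE_restrict_space_iff) simp_all
    ultimately have "AE x in M. p x \<le> P"
      by (auto elim!: eventually_mono intro: order_trans simp flip: ereal_less_eq(3))
    then show ?thesis
      using maps_imp_ess_bounded[OF assms(2,3) that(3) p(3) phi_minus_AE[OF p(1,2)]] by blast
  qed
  have c3: "(ess_bounded M (u_deriv M \<phi>) \<longleftrightarrow> maps_Lp_into_itself M p \<phi>) \<and>
        (maps_Lp_into_itself M p \<phi> \<longleftrightarrow> U_const M \<phi> < \<infinity>)"
    if p: "p \<in> P_log M x0 \<phi>" and "doubling M" for p
  proof -
    have pp: "p \<in> P_log_plus M x0 \<phi>" "p \<in> P_log_minus M \<phi>" using p by (auto simp: P_log_def)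
    then have "p \<in> LH_inf x0" by (auto simp: P_log_plus_def LH_def)
    then obtain P where "\<And>x. p x \<le> P" using LH_inf_bounded by metis
    moreover have "p \<in> exponents" using \<open>p \<in> LH_inf x0\<close> by (simp add: LH_inf_def)
    ultimately have fin: "exp_plus M p UNIV < \<infinity>"
      using emeasure_open_pos[of UNIV] by (intro exp_plus_bounds) auto
    have "maps_Lp_into_itself M p \<phi> \<Longrightarrow> ess_bounded M (u_deriv M \<phi>)" using c2 pp(2) fin by blast
    moreover have "ess_bounded M (u_deriv M \<phi>) \<Longrightarrow> maps_Lp_into_itself M p \<phi>" using c1 pp(1) by blast
    moreover have "ess_bounded M (u_deriv M \<phi>) \<longleftrightarrow> U_const M \<phi> < \<infinity>"
      using ess_bounded_imp_U_const_finite U_const_finite_imp_ess_bounded[OF \<open>doubling M\<close>] by blast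
    ultimately show ?thesis by blast
  qed
  show ?thesis using c1 c2 c3 ess_bounded_imp_U_const_finite by blast
qed

end
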